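(* Let a DC cube be defined by 8 corner points $p_0=\infty$, $p_1,p_2,p_4\in\operatorname{Im}\mathbb H$, $p_3,p_5,p_6$ on the lines $\mathcal L(p_1,p_2)$, $\mathcal L(p_1,p_4)$, $\mathcal L(p_2,p_4)$ respectively, with the associated Miquel point $p_7$, and by an orthonormal frame $(v_1,v_2,v_3)$ at $p_0$ with $v_3=v_1v_2$ (quaternion product). Then this DC cube can be parametrized by the trivariate quaternionic Bézier formula $$F(s,t,u)=\frac{\sum_{i,j,k=0}^{1}p_{ijk}w_{ijk}\,B^1_i(s)B^1_j(t)B^1_k(u)}{\sum_{i,j,k=0}^{1}w_{ijk}\,B^1_i(s)B^1_j(t)B^1_k(u)},$$ where the first 7 homogeneous control points $(p_iw_i,w_i)$, $i=0,\dots,6$, are the columns of $$\begin{pmatrix} 1 & -p_1v_1 & -p_2v_2 & p_3(p_1-p_2)v_3 & -p_4v_3 & p_5(p_4-p_1)v_2 & p_6(p_2-p_4)v_1\\ 0 & -v_1 & -v_2 & (p_1-p_2)v_3 & -v_3 & (p_4-p_1)v_2 & (p_2-p_4)v_1 \end{pmatrix}$$ (so for $i=0$ the pair "$(p_0w_0,w_0)$" stands for $(1,0)$), and the last one is $(p_7w_7,w_7)$, where $w_7$ has the following equivalent expressions: $$\begin{aligned} w_7&=(p_7-p_1)^{-1}(p_4-p_1)(p_3-p_5)(p_1-p_2)\\ &=(p_7-p_2)^{-1}(p_1-p_2)(p_6-p_3)(p_2-p_4)\\ &=(p_7-p_4)^{-1}(p_2-p_4)(p_5-p_6)(p_4-p_1).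 \end{aligned}$$
   Context: $\mathbb H$ is the algebra of real quaternions. $\operatorname{Im}\mathbb H$ is the space of purely imaginary quaternions, identified with Euclidean $\mathbb R^3$, and $\widehat{\mathbb R}^3=\operatorname{Im}\mathbb H\cup\{\infty\}$. The quaternionic fraction is $\frac{U}{W}=UW^{-1}$ if $W\neq0$, and $\frac UW=\infty$ if $W=0$. $B^1_0(t)=1-t$, $B^1_1(t)=t$. $\mathcal L(p,q)$ is the line through $p$ and $q$. Index convention: a triple of binary digits $ijk$ is identified with the integer $i+2j+4k$, so $000=0$, $100=1$, $010=2$, $110=3$, $001=4$, $101=5$, $011=6$, $111=7$; thus $p_{ijk}=p_{i+2j+4k}$ and $w_{ijk}=w_{i+2j+4k}$. DC (Dupin cyclidic) cube: a map $F:[0,1]^3\to\widehat{\mathbb R}^3$, $F=U/W$, where $U,W$ are polynomials in the real variables $s,t,u$ with quaternionic coefficients, of degree at most one in each variable, such that $\partial_sF,\partial_tF,\partial_uF$ are mutually orthogonal and the Jacobian of $F$ is not identically zero. Its corner points are $p_{ijk}=F(i,j,k)$, $i,j,k\in\{0,1\}$. A DC cube is determined, up to reparametrization, by its three faces at the corner $p_0$, and these are determined by their corner points and the frame at $p_0$. When $p_0=\infty$, the frame $(v_1,v_2,v_3)$ at $p_0$ means that the edges joining $p_0$ to $p_1$, $p_2$, $p_4$ are the half-lines starting from $p_1,p_2,p_4$ in the directions $v_1,v_2,v_3$ respectively. Miquel point: the common point of the circle through $p_1,p_3,p_5$, the circle through $p_2,p_3,p_6$ and the circle through $p_4,p_5,p_6$,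 provided by Miquel's theorem. *)

theory Defs
  imports "HOL-Analysis.Analysis"
begin

datatype quat = Quat (q_re: real) (q_i: real) (q_j: real) (q_k: real)

lemma quat_eq_iff:
  "x = y \<longleftrightarrow> q_re x = q_re y \<and> q_i x = q_i y \<and> q_j x = q_j y \<and> q_k x = q_k y"
  by (cases x; cases y) simp

instantiation quat :: ring_1
begin

definition zero_quat :: quat where "0 = Quat 0 0 0 0"
definition one_quat :: quat where "1 = Quat 1 0 0 0"
definition plus_quat :: "quat \<Rightarrow> quat \<Rightarrow> quat" where
  "x + y = Quat (q_re x + q_re y) (q_i x + q_i y) (q_j x + q_j y) (q_k x + q_k y)"
definition uminus_quat :: "quat \<Rightarrow> quat" where
  "- x = Quat (- q_re x) (- q_i x) (- q_j x) (- q_k x)"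
definition minus_quat :: "quat \<Rightarrow> quat \<Rightarrow> quat" where
  "x - y = Quat (q_re x - q_re y) (q_i x - q_i y) (q_j x - q_j y) (q_k x - q_k y)"
definition times_quat :: "quat \<Rightarrow> quat \<Rightarrow> quat" where
  "x * y = Quat
     (q_re x * q_re y - q_i x * q_i y - q_j x * q_j y - q_k x * q_k y)
     (q_re x * q_i y + q_i x * q_re y + q_j x * q_k y - q_k x * q_j y)
     (q_re x * q_j y - q_i x * q_k y + q_j x * q_re y + q_k x * q_i y)
     (q_re x * q_k y + q_i x * q_j y - q_j x * q_i y + q_k x * q_re y)"

instance
  by standard
    (simp_all add: quat_eq_iff zero_quat_def one_quat_def plus_quat_def uminus_quat_def
      minus_quat_def times_quat_def algebra_simps)

end

lemma quat_zero_simps [simp]: "q_re 0 = 0" "q_i 0 = 0" "q_j 0 = 0" "q_k 0 = 0"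
  by (simp_all add: zero_quat_def)

lemma quat_one_simps [simp]: "q_re 1 = 1" "q_i 1 = 0" "q_j 1 = 0" "q_k 1 = 0"
  by (simp_all add: one_quat_def)

lemma quat_add_simps [simp]:
  "q_re (x + y) = q_re x + q_re y" "q_i (x + y) = q_i x + q_i y"
  "q_j (x + y) = q_j x + q_j y" "q_k (x + y) = q_k x + q_k y"
  by (simp_all add: plus_quat_def)

lemma quat_minus_simps [simp]:
  "q_re (- x) = - q_re x" "q_i (- x) = - q_i x" "q_j (- x) = - q_j x" "q_k (- x) = - q_k x"
  by (simp_all add: uminus_quat_def)

lemma quat_diff_simps [simp]:
  "q_re (x - y) = q_re x - q_re y" "q_i (x - y) = q_i x - q_i y"
  "q_j (x - y) = q_j x - q_j y" "q_k (x - y) = q_k x - q_k y"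
  by (simp_all add: minus_quat_def)

lemma quat_mult_simps [simp]:
  "q_re (x * y) = q_re x * q_re y - q_i x * q_i y - q_j x * q_j y - q_k x * q_k y"
  "q_i (x * y) = q_re x * q_i y + q_i x * q_re y + q_j x * q_k y - q_k x * q_j y"
  "q_j (x * y) = q_re x * q_j y - q_i x * q_k y + q_j x * q_re y + q_k x * q_i y"
  "q_k (x * y) = q_re x * q_k y + q_i x * q_j y - q_j x * q_i y + q_k x * q_re y"
  by (simp_all add: times_quat_def)

instantiation quat :: real_algebra_1
begin

definition scaleR_quat :: "real \<Rightarrow> quat \<Rightarrow> quat" where
  "r *\<^sub>R x = Quat (r * q_re x) (r * q_i x) (r * q_j x) (r * q_k x)"

instance
  by standard (simp_all add: quat_eq_iff scaleR_quat_def algebra_simps)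

end

lemma quat_scaleR_simps [simp]:
  "q_re (r *\<^sub>R x) = r * q_re x" "q_i (r *\<^sub>R x) = r * q_i x"
  "q_j (r *\<^sub>R x) = r * q_j x" "q_k (r *\<^sub>R x) = r * q_k x"
  by (simp_all add: scaleR_quat_def)

lemma quat_sumsq_eq_0_iff:
  "(q_re x)\<^sup>2 + (q_i x)\<^sup>2 + (q_j x)\<^sup>2 + (q_k x)\<^sup>2 = 0 \<longleftrightarrow> x = 0"
  by (simp add: quat_eq_iff add_nonneg_eq_0_iff)

instantiation quat :: real_div_algebra
begin

definition inverse_quat :: "quat \<Rightarrow> quat" where
  "inverse x = (1 / ((q_re x)\<^sup>2 + (q_i x)\<^sup>2 + (q_j x)\<^sup>2 + (q_k x)\<^sup>2)) *\<^sub>R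
     Quat (q_re x) (- q_i x) (- q_j x) (- q_k x)"
definition divide_quat :: "quat \<Rightarrow> quat \<Rightarrow> quat" where
  "x div y = x * inverse (y::quat)"

instance
proof
  fix x y :: quat
  show "inverse 0 = (0::quat)"
    by (simp add: inverse_quat_def quat_eq_iff)
  show "x div y = x * inverse y"
    by (simp add: divide_quat_def)
  assume "x \<noteq> 0"
  then have "(q_re x)\<^sup>2 + (q_i x)\<^sup>2 + (q_j x)\<^sup>2 + (q_k x)\<^sup>2 \<noteq> 0"
    by (simp add: quat_sumsq_eq_0_iff)
  then show "inverse x * x = 1" "x * inverse x = 1"
    by (simp_all add: inverse_quat_def quat_eq_iff power2_eq_square add_divide_distrib [symmetric])
qed

end

instantiation quat :: real_inner
begin

definition inner_quat :: "quat \<Rightarrow> quat \<Rightarrow> real" where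
  "x \<bullet> y = q_re x * q_re y + q_i x * q_i y + q_j x * q_j y + q_k x * q_k y"
definition norm_quat :: "quat \<Rightarrow> real" where
  "norm x = sqrt (x \<bullet> (x::quat))"
definition sgn_quat :: "quat \<Rightarrow> quat" where
  "sgn x = x /\<^sub>R norm (x::quat)"
definition dist_quat :: "quat \<Rightarrow> quat \<Rightarrow> real" where
  "dist x y = norm (x - y :: quat)"
definition uniformity_quat :: "(quat \<times> quat) filter" where
  "uniformity = (INF e\<in>{0<..}. principal {(x, y). dist x (y::quat) < e})"
definition open_quat :: "quat set \<Rightarrow> bool" where
  "open U \<longleftrightarrow> (\<forall>x\<in>U. eventually (\<lambda>(x', y). x' = x \<longrightarrow> y \<in> (U :: quat set)) uniformity)"

instance
proof
  fix x y z :: quat and r :: real and U :: "quat set"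
  show "dist x y = norm (x - y)" by (rule dist_quat_def)
  show "sgn x = x /\<^sub>R norm x" by (rule sgn_quat_def)
  show "uniformity = (INF e\<in>{0<..}. principal {(x, y). dist x (y::quat) < e})"
    by (rule uniformity_quat_def)
  show "open U \<longleftrightarrow> (\<forall>x\<in>U. eventually (\<lambda>(x', y). x' = x \<longrightarrow> y \<in> U) uniformity)"
    by (rule open_quat_def)
  show "x \<bullet> y = y \<bullet> x" by (simp add: inner_quat_def mult.commute)
  show "(x + y) \<bullet> z = x \<bullet> z + y \<bullet> z" by (simp add: inner_quat_def algebra_simps)
  show "r *\<^sub>R x \<bullet> y = r * (x \<bullet> y)" by (simp add: inner_quat_def algebra_simps)
  show "0 \<le> x \<bullet> x" by (simp add: inner_quat_def)
  show "x \<bullet> x = 0 \<longleftrightarrow> x = 0"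
    using quat_sumsq_eq_0_iff [of x] by (simp add: inner_quat_def power2_eq_square)
  show "norm x = sqrt (x \<bullet> x)" by (rule norm_quat_def)
qed

end

instance quat :: real_normed_div_algebra
proof
  fix x y :: quat
  have "(x * y) \<bullet> (x * y) = (x \<bullet> x) * (y \<bullet> y)"
    by (simp add: inner_quat_def algebra_simps)
  then show "norm (x * y) = norm x * norm y"
    by (simp add: norm_quat_def real_sqrt_mult)
qed

definition Im_quat :: "quat set" where
  "Im_quat = {q. q_re q = 0}"

definition im_coords :: "quat \<Rightarrow> real ^ 3" where
  "im_coords q = vector [q_i q, q_j q, q_k q]"

text \<open>A one-point extension is modelled by the type \<open>quat option\<close>, with \<open>None\<close> as the point at
  infinity.\<close>

definition ext_R3 :: "quat option set" where
  "ext_R3 = insert None (Some ` Im_quat)"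

definition qfrac :: "quat \<Rightarrow> quat \<Rightarrow> quat option" where
  "qfrac U W = (if W = 0 then None else Some (U * inverse W))"

definition trilinear_poly :: "(real \<Rightarrow> real \<Rightarrow> real \<Rightarrow> quat) \<Rightarrow> bool" where
  "trilinear_poly P \<longleftrightarrow> (\<exists>c :: nat \<Rightarrow> nat \<Rightarrow> nat \<Rightarrow> quat. \<forall>s t u.
     P s t u = (\<Sum>i\<le>1. \<Sum>j\<le>1. \<Sum>k\<le>1. (s ^ i * t ^ j * u ^ k) *\<^sub>R c i j k))"

text \<open>The partial derivatives below are one-sided at the boundary of the cube; they are only used at
  points where the map is finite.\<close>

definition deriv_s :: "(real \<Rightarrow> real \<Rightarrow> real \<Rightarrow> quat option) \<Rightarrow> real \<Rightarrow> real \<Rightarrow> real \<Rightarrow> quat" where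
  "deriv_s F s t u = vector_derivative (\<lambda>x. the (F x t u)) (at s within {0..1})"

definition deriv_t :: "(real \<Rightarrow> real \<Rightarrow> real \<Rightarrow> quat option) \<Rightarrow> real \<Rightarrow> real \<Rightarrow> real \<Rightarrow> quat" where
  "deriv_t F s t u = vector_derivative (\<lambda>x. the (F s x u)) (at t within {0..1})"

definition deriv_u :: "(real \<Rightarrow> real \<Rightarrow> real \<Rightarrow> quat option) \<Rightarrow> real \<Rightarrow> real \<Rightarrow> real \<Rightarrow> quat" where
  "deriv_u F s t u = vector_derivative (\<lambda>x. the (F s t x)) (at u within {0..1})"

definition jacobian :: "(real \<Rightarrow> real \<Rightarrow> real \<Rightarrow> quat option) \<Rightarrow> real \<Rightarrow> real \<Rightarrow> real \<Rightarrow> real" where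
  "jacobian F s t u = det (vector
     [im_coords (deriv_s F s t u), im_coords (deriv_t F s t u), im_coords (deriv_u F s t u)]
     :: real ^ 3 ^ 3)"

text \<open>Only the values of \<open>F\<close> on the unit cube matter.\<close>

definition DC_cube :: "(real \<Rightarrow> real \<Rightarrow> real \<Rightarrow> quat option) \<Rightarrow> bool" where
  "DC_cube F \<longleftrightarrow>
     (\<exists>U W. trilinear_poly U \<and> trilinear_poly W \<and>
        (\<forall>s\<in>{0..1}. \<forall>t\<in>{0..1}. \<forall>u\<in>{0..1}. F s t u = qfrac (U s t u) (W s t u))) \<and>
     (\<forall>s\<in>{0..1}. \<forall>t\<in>{0..1}. \<forall>u\<in>{0..1}. F s t u \<in> ext_R3) \<and>
     (\<forall>s\<in>{0..1}. \<forall>t\<in>{0..1}. \<forall>u\<in>{0..1}. F s t u \<noteq> None \<longrightarrow>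
        orthogonal (deriv_s F s t u) (deriv_t F s t u) \<and>
        orthogonal (deriv_s F s t u) (deriv_u F s t u) \<and>
        orthogonal (deriv_t F s t u) (deriv_u F s t u)) \<and>
     (\<exists>s\<in>{0..1}. \<exists>t\<in>{0..1}. \<exists>u\<in>{0..1}. F s t u \<noteq> None \<and> jacobian F s t u \<noteq> 0)"

text \<open>The corner \<open>F(i,j,k)\<close> carries the index \<open>i + 2j + 4k\<close>.\<close>

definition has_corners :: "(real \<Rightarrow> real \<Rightarrow> real \<Rightarrow> quat option) \<Rightarrow> quat option list \<Rightarrow> bool" where
  "has_corners F P \<longleftrightarrow>
     (\<forall>i\<le>1. \<forall>j\<le>1. \<forall>k\<le>1. F (real i) (real j) (real k) = P ! (i + 2 * j + 4 * k))"

text \<open>An edge from infinity to \<open>p\<close> in direction \<open>v\<close>: the half-line starting from \<open>p\<close>, together with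
  its end at infinity.\<close>

definition half_line :: "quat \<Rightarrow> quat \<Rightarrow> quat option set" where
  "half_line p v = insert None {Some (p + r *\<^sub>R v) | r. r \<ge> 0}"

definition has_frame_at_infinity ::
    "(real \<Rightarrow> real \<Rightarrow> real \<Rightarrow> quat option) \<Rightarrow> quat \<Rightarrow> quat \<Rightarrow> quat \<Rightarrow> quat \<Rightarrow> quat \<Rightarrow> quat \<Rightarrow> bool" where
  "has_frame_at_infinity F p\<^sub>1 p\<^sub>2 p\<^sub>4 v\<^sub>1 v\<^sub>2 v\<^sub>3 \<longleftrightarrow>
     (\<lambda>s. F s 0 0) ` {0..1} = half_line p\<^sub>1 v\<^sub>1 \<and>
     (\<lambda>t. F 0 t 0) ` {0..1} = half_line p\<^sub>2 v\<^sub>2 \<and>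
     (\<lambda>u. F 0 0 u) ` {0..1} = half_line p\<^sub>4 v\<^sub>3"

text \<open>Reparametrizations of a DC cube act on each variable separately by an increasing
  fractional-linear bijection of the unit interval. These are the changes of variable that keep
  \<open>U\<close> and \<open>W\<close> of degree at most one in each variable and fix all corners.\<close>

definition interval_moebius :: "real \<Rightarrow> real \<Rightarrow> real" where
  "interval_moebius a x = a * x / ((1 - x) + a * x)"

definition reparametrization ::
    "(real \<Rightarrow> real \<Rightarrow> real \<Rightarrow> quat option) \<Rightarrow> (real \<Rightarrow> real \<Rightarrow> real \<Rightarrow> quat option) \<Rightarrow> bool" where
  "reparametrization F G \<longleftrightarrow> (\<exists>a>0. \<exists>b>0. \<exists>c>0. \<forall>s\<in>{0..1}. \<forall>t\<in>{0..1}. \<forall>u\<in>{0..1}.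
     G s t u = F (interval_moebius a s) (interval_moebius b t) (interval_moebius c u))"

text \<open>For non-collinear \<open>a\<close>, \<open>b\<close>, \<open>c\<close> this is the circle through the three points: the points of
  their plane at the same distance from the circumcentre \<open>m\<close>.\<close>

definition circle_through :: "quat \<Rightarrow> quat \<Rightarrow> quat \<Rightarrow> quat set" where
  "circle_through a b c = {x \<in> affine hull {a, b, c}. \<exists>m \<in> affine hull {a, b, c}.
     dist m b = dist m a \<and> dist m c = dist m a \<and> dist m x = dist m a}"

definition Miquel_point ::
    "quat \<Rightarrow> quat \<Rightarrow> quat \<Rightarrow> quat \<Rightarrow> quat \<Rightarrow> quat \<Rightarrow> quat \<Rightarrow> bool" where
  "Miquel_point p\<^sub>1 p\<^sub>2 p\<^sub>3 p\<^sub>4 p\<^sub>5 p\<^sub>6 x \<longleftrightarrow>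
     \<not> collinear {p\<^sub>1, p\<^sub>3, p\<^sub>5} \<and> \<not> collinear {p\<^sub>2, p\<^sub>3, p\<^sub>6} \<and> \<not> collinear {p\<^sub>4, p\<^sub>5, p\<^sub>6} \<and>
     x \<in> circle_through p\<^sub>1 p\<^sub>3 p\<^sub>5 \<and> x \<in> circle_through p\<^sub>2 p\<^sub>3 p\<^sub>6 \<and> x \<in> circle_through p\<^sub>4 p\<^sub>5 p\<^sub>6"

definition trilinear_Bernstein_sum :: "quat list \<Rightarrow> real \<Rightarrow> real \<Rightarrow> real \<Rightarrow> quat" where
  "trilinear_Bernstein_sum c s t u = (\<Sum>i\<le>1. \<Sum>j\<le>1. \<Sum>k\<le>1.
     (Bernstein 1 i s * Bernstein 1 j t * Bernstein 1 k u) *\<^sub>R (c ! (i + 2 * j + 4 * k)))"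

text \<open>The eight control points are homogeneous pairs \<open>(p w, w)\<close>, respectively \<open>(1, 0)\<close> for a control
  point at infinity.\<close>

definition quat_Bezier :: "(quat \<times> quat) list \<Rightarrow> real \<Rightarrow> real \<Rightarrow> real \<Rightarrow> quat option" where
  "quat_Bezier cs s t u =
     qfrac (trilinear_Bernstein_sum (map fst cs) s t u) (trilinear_Bernstein_sum (map snd cs) s t u)"

end

theory Submission
  imports Defs
begin

text \<open>
  Write \<open>P = (U, W)\<close> for the homogeneous trilinear map and
  \<open>pol (U, W) (U', W') = W\<^sup>* U' + U\<^sup>* W'\<close>. The condition \<open>F = U W\<^sup>-\<^sup>1 \<in> Im \<H>\<close> says that \<open>P\<close> is
  isotropic for this form, and then \<open>\<partial>\<^sub>s F = (W\<^sup>*)\<^sup>-\<^sup>1 pol P (\<partial>\<^sub>s P) W\<^sup>-\<^sup>1\<close>, where \<open>pol P (\<partial>\<^sub>s P)\<close> does not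
  depend on \<open>s\<close>. So the orthogonality conditions concern three quaternionic polynomials \<open>A(t,u)\<close>,
  \<open>B(s,u)\<close>, \<open>C(s,t)\<close>, biquadratic in their variables. For the Bezier net of the theorem these turn
  out to be real multiples of the constants \<open>v\<^sub>1\<close>, \<open>v\<^sub>2\<close>, \<open>v\<^sub>3\<close>, which gives existence.

  For uniqueness, the frame determines the weights at \<open>p\<^sub>1, p\<^sub>2, p\<^sub>4\<close> up to the three positive factors
  of a reparametrization. If two nets agree at \<open>p\<^sub>0, p\<^sub>1, p\<^sub>2\<close>, the difference \<open>\<delta>\<close> of their
  weights at \<open>p\<^sub>3\<close> is orthogonal to \<open>v\<^sub>1, v\<^sub>2\<close>, and the middle coefficient of \<open>A \<bullet> B = 0\<close> becomes
  \<open>\<delta> \<bullet> \<delta> = 0\<close>. Once all corners but \<open>p\<^sub>7\<close> agree, the central coefficients of \<open>A\<close>, \<open>B\<close>, \<open>C\<close> differ by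
  the difference of the weights at \<open>p\<^sub>7\<close>, which is therefore orthogonal to \<open>1, v\<^sub>1, v\<^sub>2, v\<^sub>3\<close>. The formula for
  \<open>w\<^sub>7\<close> comes from Miquel's theorem: subtracting two circle equations gives a linear equation
  for \<open>p\<^sub>7\<close>.
\<close>

section \<open>Conjugation and the polar form\<close>

definition qcnj :: "quat \<Rightarrow> quat" where
  "qcnj x = Quat (q_re x) (- q_i x) (- q_j x) (- q_k x)"

lemma qcnj_sel [simp]:
  "q_re (qcnj x) = q_re x" "q_i (qcnj x) = - q_i x"
  "q_j (qcnj x) = - q_j x" "q_k (qcnj x) = - q_k x"
  by (simp_all add: qcnj_def)

lemma qcnj_simps [simp]:
  "qcnj (x + y) = qcnj x + qcnj y" "qcnj (x - y) = qcnj x - qcnj y" "qcnj (- x) = - qcnj x"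
  "qcnj (x * y) = qcnj y * qcnj x" "qcnj (r *\<^sub>R x) = r *\<^sub>R qcnj x" "qcnj (qcnj x) = x"
  "qcnj 0 = 0" "qcnj 1 = 1"
  by (simp_all add: quat_eq_iff algebra_simps)

lemma qcnj_Im: "x \<in> Im_quat \<Longrightarrow> qcnj x = - x"
  by (simp add: Im_quat_def quat_eq_iff)

lemma Im_quat_iff_qcnj: "x \<in> Im_quat \<longleftrightarrow> qcnj x = - x"
  by (auto simp: Im_quat_def quat_eq_iff)

lemma inner_one_quat: "1 \<bullet> x = q_re x"
  by (simp add: inner_quat_def)

lemma norm_power2_quat: "(norm x)\<^sup>2 = (q_re x)\<^sup>2 + (q_i x)\<^sup>2 + (q_j x)\<^sup>2 + (q_k x)\<^sup>2"
  by (simp add: norm_quat_def inner_quat_def power2_eq_square)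

lemma qcnj_mult_self: "qcnj x * x = of_real ((norm x)\<^sup>2)" "x * qcnj x = of_real ((norm x)\<^sup>2)"
  unfolding norm_power2_quat by (simp_all add: quat_eq_iff of_real_def power2_eq_square)

lemma norm_qcnj [simp]: "norm (qcnj x) = norm x"
  by (simp add: norm_quat_def inner_quat_def)

lemma qcnj_eq_0_iff [simp]: "qcnj x = 0 \<longleftrightarrow> x = 0"
  by (auto simp: quat_eq_iff)

lemma inverse_qcnj: "inverse (qcnj x) = (1 / (norm x)\<^sup>2) *\<^sub>R x"
proof (cases "x = 0")
  case False
  then have "qcnj x * ((1 / (norm x)\<^sup>2) *\<^sub>R x) = 1"
    by (simp add: qcnj_mult_self of_real_def)
  then show ?thesis by (rule inverse_unique)
qed simp

lemma Im_square: "x \<in> Im_quat \<Longrightarrow> x * x = - of_real ((norm x)\<^sup>2)"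
  using qcnj_mult_self(1) [of x] by (simp add: qcnj_Im minus_equation_iff [of "x * x"])

lemma Im_anticommute: "x \<in> Im_quat \<Longrightarrow> y \<in> Im_quat \<Longrightarrow> x * y + y * x = - of_real (2 * (x \<bullet> y))"
  by (simp add: Im_quat_def quat_eq_iff inner_quat_def of_real_def)

definition pol :: "quat \<times> quat \<Rightarrow> quat \<times> quat \<Rightarrow> quat" where
  "pol x y = qcnj (snd x) * fst y + qcnj (fst x) * snd y"

lemma pol_simps [simp]:
  "pol (x + y) z = pol x z + pol y z" "pol z (x + y) = pol z x + pol z y"
  "pol (r *\<^sub>R x) z = r *\<^sub>R pol x z" "pol z (r *\<^sub>R x) = r *\<^sub>R pol z x"
  by (simp_all add: pol_def algebra_simps)

lemma qcnj_pol: "qcnj (pol x y) = pol y x"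
  by (simp add: pol_def add.commute)

section \<open>Linear and quadratic Bernstein forms\<close>

definition lin :: "real \<Rightarrow> 'a::real_vector \<Rightarrow> 'a \<Rightarrow> 'a" where
  "lin x a b = (1 - x) *\<^sub>R a + x *\<^sub>R b"

text \<open>The binomial factor 2 of the Bernstein basis is absorbed into \<open>b\<close>, so that
  the middle coefficient in \<open>pol_lin\<close> is just the sum of the two mixed polar
  terms.\<close>

definition quad :: "real \<Rightarrow> 'a::real_vector \<Rightarrow> 'a \<Rightarrow> 'a \<Rightarrow> 'a" where
  "quad x a b c = (1 - x)\<^sup>2 *\<^sub>R a + (x * (1 - x)) *\<^sub>R b + x\<^sup>2 *\<^sub>R c"

lemma lin_0_1 [simp]: "lin 0 a b = a" "lin 1 a b = b"
  by (simp_all add: lin_def)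

lemma fst_lin [simp]: "fst (lin x a b) = lin x (fst a) (fst b)"
  and snd_lin [simp]: "snd (lin x a b) = lin x (snd a) (snd b)"
  by (simp_all add: lin_def)

lemma pol_lin: "pol (lin x a b) (lin x c d) = quad x (pol a c) (pol a d + pol b c) (pol b d)"
  by (simp add: lin_def quad_def power2_eq_square scaleR_add_right mult.commute)

lemma inner_quad: "e \<bullet> quad x a b c = quad x (e \<bullet> a) (e \<bullet> b) (e \<bullet> c)"
  by (simp add: quad_def inner_add_right)

lemma quad_add: "quad x (a + a') (b + b') (c + c') = quad x a b c + quad x a' b' c'"
  by (simp add: quad_def algebra_simps)

text \<open>A nonzero polynomial of degree at most two has finitely many roots. Any infinite
  \<open>S\<close> is allowed because orthogonality is known only where the denominator does not
  vanish.\<close>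

lemma quad_vanish:
  fixes a b c :: real
  assumes "infinite S" and "\<And>x. x \<in> S \<Longrightarrow> quad x a b c = 0"
  shows "a = 0" "b = 0" "c = 0"
proof -
  \<comment> \<open>Monomial coefficients of the Bernstein form.\<close>
  define k where "k i = (if i = 0 then a else if i = 1 then b - 2 * a else a - b + c)" for i :: nat
  have k: "(\<Sum>i\<le>2. k i * x ^ i) = quad x a b c" for x
    by (simp add: k_def quad_def numeral_2_eq_2 algebra_simps power2_eq_square)
  have "k i = 0" if "i \<le> 2" for i
  proof (rule ccontr)
    assume "k i \<noteq> 0"
    then have "finite {x. (\<Sum>i\<le>2. k i * x ^ i) = 0}"
      using Transcendental.polyfun_rootbound [where c = k and n = 2 and k = i] that by simp
    moreover have "S \<subseteq> {x. (\<Sum>i\<le>2. k i * x ^ i) = 0}"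
      using assms(2) by (auto simp: k)
    ultimately show False using assms(1) finite_subset by blast
  qed
  from this [of 0] this [of 1] this [of 2] show "a = 0" "b = 0" "c = 0"
    by (simp_all add: k_def)
qed

text \<open>An affine path with two zeros vanishes identically, so one starting at a nonzero vector
  has at most one zero.\<close>

lemma infinite_lin_nonzero:
  assumes "a \<noteq> 0"
  shows "infinite {x \<in> {0<..<1}. lin x a b \<noteq> 0}"
proof -
  have uniq: "x = y" if "lin x a b = 0" "lin y a b = 0" for x y
  proof (rule ccontr)
    assume "x \<noteq> y"
    have "lin x a b - lin y a b = (x - y) *\<^sub>R (b - a)"
      by (simp add: lin_def algebra_simps)
    with that \<open>x \<noteq> y\<close> have "b = a" by simp
    with that(1) have "a = 0" by (simp add: lin_def algebra_simps)
    with assms show False by contradiction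
  qed
  have "finite {x. lin x a b = 0}"
  proof (cases "\<exists>y. lin y a b = 0")
    case True
    then obtain y where "lin y a b = 0" by blast
    then have "{x. lin x a b = 0} \<subseteq> {y}" using uniq by blast
    then show ?thesis using finite_subset by blast
  qed simp
  moreover have "infinite {0<..<1::real}" by simp
  moreover have "{0<..<1} - {x. lin x a b = 0} = {x \<in> {0<..<1}. lin x a b \<noteq> 0}" by auto
  ultimately show ?thesis by (metis Diff_infinite_finite)
qed

section \<open>Trilinear nets\<close>

text \<open>The equations are asked only on the closed cube: the rescaled nets below contain
  fractional-linear parameters, which may have poles outside it.\<close>

definition multiaffine :: "(real \<Rightarrow> real \<Rightarrow> real \<Rightarrow> 'a::real_vector) \<Rightarrow> bool" where
  "multiaffine P \<longleftrightarrow> (\<forall>s\<in>{0..1}. \<forall>t\<in>{0..1}. \<forall>u\<in>{0..1}.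
     P s t u = lin s (P 0 t u) (P 1 t u) \<and> P s t u = lin t (P s 0 u) (P s 1 u) \<and>
     P s t u = lin u (P s t 0) (P s t 1))"

text \<open>A cyclic shift of the parameters, by which statements on the first one or two parameters
  transfer to the others: \<open>edge (rot P) u s\<close> and \<open>edge (rot (rot P)) s t\<close>
  are the forms of the \<open>t\<close> and \<open>u\<close> directions.\<close>

definition rot :: "(real \<Rightarrow> real \<Rightarrow> real \<Rightarrow> 'a) \<Rightarrow> real \<Rightarrow> real \<Rightarrow> real \<Rightarrow> 'a" where
  "rot P s t u = P u s t"

definition edge :: "(real \<Rightarrow> real \<Rightarrow> real \<Rightarrow> quat \<times> quat) \<Rightarrow> real \<Rightarrow> real \<Rightarrow> quat" where
  "edge P t u = pol (P 0 t u) (P 1 t u)"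

text \<open>Coefficient of \<open>t (1 - t) u (1 - u)\<close> in the biquadratic
  \<open>edge P t u\<close>; its terms belong to the four space diagonals of the cube.\<close>

definition edge_centre :: "(real \<Rightarrow> real \<Rightarrow> real \<Rightarrow> quat \<times> quat) \<Rightarrow> quat" where
  "edge_centre P = pol (P 0 0 0) (P 1 1 1) + pol (P 0 0 1) (P 1 1 0) +
     pol (P 0 1 0) (P 1 0 1) + pol (P 0 1 1) (P 1 0 0)"

definition isotropic :: "(real \<Rightarrow> real \<Rightarrow> real \<Rightarrow> quat \<times> quat) \<Rightarrow> bool" where
  "isotropic P \<longleftrightarrow> (\<forall>s\<in>{0..1}. \<forall>t\<in>{0..1}. \<forall>u\<in>{0..1}. pol (P s t u) (P s t u) = 0)"

text \<open>Orthogonality of the first two partial derivatives, freed of the factors that surround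
  the edge forms. The other two pairs of directions are covered by \<open>rot P\<close> and
  \<open>rot (rot P)\<close>.\<close>

definition orth12 :: "(real \<Rightarrow> real \<Rightarrow> real \<Rightarrow> quat \<times> quat) \<Rightarrow> bool" where
  "orth12 P \<longleftrightarrow> (\<forall>s\<in>{0..1}. \<forall>t\<in>{0..1}. \<forall>u\<in>{0..1}. snd (P s t u) \<noteq> 0 \<longrightarrow>
     edge P t u \<bullet> edge (rot P) u s = 0)"

lemma rot3: "rot (rot (rot P)) = P"
  by (simp add: rot_def fun_eq_iff)

lemma multiaffine_rot: "multiaffine P \<Longrightarrow> multiaffine (rot P)"
  unfolding multiaffine_def rot_def by blast

lemma isotropic_rot: "isotropic P \<Longrightarrow> isotropic (rot P)"
  by (simp add: isotropic_def rot_def)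

lemma multiaffineD:
  assumes "multiaffine P" "s \<in> {0..1}" "t \<in> {0..1}" "u \<in> {0..1}"
  shows "P s t u = lin s (P 0 t u) (P 1 t u)" "P s t u = lin t (P s 0 u) (P s 1 u)"
    "P s t u = lin u (P s t 0) (P s t 1)"
  using assms unfolding multiaffine_def by blast+

lemma multiaffine_expand:
  assumes "multiaffine P" "s \<in> {0..1}" "t \<in> {0..1}" "u \<in> {0..1}"
  shows "P s t u = lin s (lin t (lin u (P 0 0 0) (P 0 0 1)) (lin u (P 0 1 0) (P 0 1 1)))
    (lin t (lin u (P 1 0 0) (P 1 0 1)) (lin u (P 1 1 0) (P 1 1 1)))"
proof -
  have "P i t u = lin t (lin u (P i 0 0) (P i 0 1)) (lin u (P i 1 0) (P i 1 1))" if "i \<in> {0..1}" for i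
    using multiaffineD(2) [OF assms(1) that assms(3,4)] multiaffineD(3) [OF assms(1) that, of 0 u]
      multiaffineD(3) [OF assms(1) that, of 1 u] assms(4) by simp
  from this [of 0] this [of 1] show ?thesis
    using multiaffineD(1) [OF assms] by simp
qed

lemma edge_quad_1:
  assumes "multiaffine P" "t \<in> {0..1}" "u \<in> {0..1}"
  shows "edge P t u = quad t (edge P 0 u) (pol (P 0 0 u) (P 1 1 u) + pol (P 0 1 u) (P 1 0 u)) (edge P 1 u)"
  using multiaffineD(2) [OF assms(1), of 0 t u] multiaffineD(2) [OF assms(1), of 1 t u] assms
  by (simp add: edge_def pol_lin)

lemma edge_quad_2:
  assumes "multiaffine P" "t \<in> {0..1}" "u \<in> {0..1}"
  shows "edge P t u = quad u (edge P t 0) (pol (P 0 t 0) (P 1 t 1) + pol (P 0 t 1) (P 1 t 0)) (edge P t 1)"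
  using multiaffineD(3) [OF assms(1), of 0 t u] multiaffineD(3) [OF assms(1), of 1 t u] assms
  by (simp add: edge_def pol_lin)

lemma edge_middle_quad:
  assumes "multiaffine P" "u \<in> {0..1}"
  shows "pol (P 0 0 u) (P 1 1 u) + pol (P 0 1 u) (P 1 0 u) =
    quad u (pol (P 0 0 0) (P 1 1 0) + pol (P 0 1 0) (P 1 0 0)) (edge_centre P)
      (pol (P 0 0 1) (P 1 1 1) + pol (P 0 1 1) (P 1 0 1))"
proof -
  have "P i j u = lin u (P i j 0) (P i j 1)" if "i \<in> {0..1}" "j \<in> {0..1}" for i j
    using multiaffineD(3) [OF assms(1) that assms(2)] .
  from this [of 0 0] this [of 1 1] this [of 0 1] this [of 1 0]
  have "P 0 0 u = lin u (P 0 0 0) (P 0 0 1)" "P 1 1 u = lin u (P 1 1 0) (P 1 1 1)"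
    "P 0 1 u = lin u (P 0 1 0) (P 0 1 1)" "P 1 0 u = lin u (P 1 0 0) (P 1 0 1)"
    by simp_all
  then show ?thesis
    by (simp only: pol_lin edge_centre_def flip: quad_add) (simp add: ac_simps)
qed

lemma infinite_open_interval [simp]: "infinite {0<..<1::real}" "{0<..<1::real} \<subseteq> {0..1}"
  by auto

section \<open>Orthogonality passed on to the coefficients of the edge forms\<close>

lemma edge_middle_orth:
  assumes "multiaffine P" "infinite S" "S \<subseteq> {0..1}" and "\<And>t. t \<in> S \<Longrightarrow> e \<bullet> edge P t 0 = 0"
  shows "e \<bullet> edge P 0 0 = 0" "e \<bullet> (pol (P 0 0 0) (P 1 1 0) + pol (P 0 1 0) (P 1 0 0)) = 0"
proof -
  have "quad t (e \<bullet> edge P 0 0) (e \<bullet> (pol (P 0 0 0) (P 1 1 0) + pol (P 0 1 0) (P 1 0 0)))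
     (e \<bullet> edge P 1 0) = 0" if "t \<in> S" for t
  proof -
    have "t \<in> {0..1}" using assms(3) that by blast
    then show ?thesis
      using assms(4) [OF that] edge_quad_1 [OF assms(1), of t 0] by (simp flip: inner_quad)
  qed
  from quad_vanish [OF assms(2) this]
  show "e \<bullet> edge P 0 0 = 0" "e \<bullet> (pol (P 0 0 0) (P 1 1 0) + pol (P 0 1 0) (P 1 0 0)) = 0"
    by simp_all
qed

lemma edge_middle_orth':
  assumes "multiaffine P" "infinite S" "S \<subseteq> {0..1}" "t \<in> {0..1}"
    and "\<And>u. u \<in> S \<Longrightarrow> e \<bullet> edge P t u = 0"
  shows "e \<bullet> edge P t 0 = 0" "e \<bullet> (pol (P 0 t 0) (P 1 t 1) + pol (P 0 t 1) (P 1 t 0)) = 0"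
proof -
  have "quad u (e \<bullet> edge P t 0) (e \<bullet> (pol (P 0 t 0) (P 1 t 1) + pol (P 0 t 1) (P 1 t 0)))
     (e \<bullet> edge P t 1) = 0" if "u \<in> S" for u
  proof -
    have "u \<in> {0..1}" using assms(3) that by blast
    then show ?thesis
      using assms(5) [OF that] edge_quad_2 [OF assms(1,4), of u] by (simp flip: inner_quad)
  qed
  from quad_vanish [OF assms(2) this]
  show "e \<bullet> edge P t 0 = 0" "e \<bullet> (pol (P 0 t 0) (P 1 t 1) + pol (P 0 t 1) (P 1 t 0)) = 0"
    by simp_all
qed

text \<open>Coefficients are compared twice, in \<open>t\<close> at fixed \<open>u\<close> and then
  in \<open>u\<close>. The admissible \<open>t\<close> may depend on \<open>u\<close>, which is why
  \<open>T\<close> is a family.\<close>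

lemma edge_centre_orth:
  assumes "multiaffine P" and "infinite S" "S \<subseteq> {0..1}"
    and "\<And>u. u \<in> S \<Longrightarrow> infinite (T u) \<and> T u \<subseteq> {0..1}"
    and "\<And>t u. u \<in> S \<Longrightarrow> t \<in> T u \<Longrightarrow> e \<bullet> edge P t u = 0"
  shows "e \<bullet> edge_centre P = 0"
proof -
  let ?a = "pol (P 0 0 0) (P 1 1 0) + pol (P 0 1 0) (P 1 0 0)"
  let ?c = "pol (P 0 0 1) (P 1 1 1) + pol (P 0 1 1) (P 1 0 1)"
  have "quad u (e \<bullet> ?a) (e \<bullet> edge_centre P) (e \<bullet> ?c) = 0" if "u \<in> S" for u
  proof -
    have u: "u \<in> {0..1}" using that assms(3) by blast
    have "quad t (e \<bullet> edge P 0 u) (e \<bullet> (pol (P 0 0 u) (P 1 1 u) + pol (P 0 1 u) (P 1 0 u)))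
     (e \<bullet> edge P 1 u) = 0" if "t \<in> T u" for t
    proof -
      have "t \<in> {0..1}" using assms(4) [OF \<open>u \<in> S\<close>] that by blast
      then show ?thesis
        using assms(5) [OF \<open>u \<in> S\<close> that] edge_quad_1 [OF assms(1) _ u, of t] by (simp flip: inner_quad)
    qed
    from quad_vanish(2) [of "T u", OF _ this] assms(4) [OF that]
    have "e \<bullet> (pol (P 0 0 u) (P 1 1 u) + pol (P 0 1 u) (P 1 0 u)) = 0" by blast
    then show ?thesis
      using edge_middle_quad [OF assms(1) u] by (simp only: inner_quad)
  qed
  from quad_vanish(2) [OF assms(2) this] show ?thesis .
qed

text \<open>Isotropy at parameter one half of a segment with isotropic ends kills the mixed term.\<close>

lemma isotropic_edge_Re:
  assumes "multiaffine P" "isotropic P" "t \<in> {0..1}" "u \<in> {0..1}"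
  shows "1 \<bullet> edge P t u = 0"
proof -
  have iso: "pol (P s t u) (P s t u) = 0" if "s \<in> {0..1}" for s
    using assms that by (auto simp: isotropic_def)
  have "P (1/2) t u = lin (1/2) (P 0 t u) (P 1 t u)"
    using multiaffineD(1) [OF assms(1) _ assms(3,4), of "1/2"] by fastforce
  then have "quad (1/2) (pol (P 0 t u) (P 0 t u)) (pol (P 0 t u) (P 1 t u) + pol (P 1 t u) (P 0 t u))
      (pol (P 1 t u) (P 1 t u)) = 0"
    using iso [of "1/2"] by (simp add: pol_lin)
  then have "pol (P 0 t u) (P 1 t u) + qcnj (pol (P 0 t u) (P 1 t u)) = 0"
    using iso [of 0] iso [of 1] by (simp add: quad_def qcnj_pol)
  then have "q_re (pol (P 0 t u) (P 1 t u) + qcnj (pol (P 0 t u) (P 1 t u))) = 0" by simp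
  then show ?thesis by (simp add: inner_one_quat edge_def)
qed

section \<open>Rigidity of orthogonal nets\<close>

text \<open>The whole multiplication table is recorded, so that products rewrite directly and the
  cyclic shift of the frame is immediate.\<close>

definition quat_frame :: "quat \<Rightarrow> quat \<Rightarrow> quat \<Rightarrow> bool" where
  "quat_frame v\<^sub>1 v\<^sub>2 v\<^sub>3 \<longleftrightarrow> v\<^sub>1 \<in> Im_quat \<and> v\<^sub>2 \<in> Im_quat \<and> v\<^sub>3 \<in> Im_quat \<and>
     v\<^sub>1 * v\<^sub>1 = - 1 \<and> v\<^sub>2 * v\<^sub>2 = - 1 \<and> v\<^sub>3 * v\<^sub>3 = - 1 \<and>
     v\<^sub>1 * v\<^sub>2 = v\<^sub>3 \<and> v\<^sub>2 * v\<^sub>3 = v\<^sub>1 \<and> v\<^sub>3 * v\<^sub>1 = v\<^sub>2 \<and>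
     v\<^sub>2 * v\<^sub>1 = - v\<^sub>3 \<and> v\<^sub>3 * v\<^sub>2 = - v\<^sub>1 \<and> v\<^sub>1 * v\<^sub>3 = - v\<^sub>2"

lemma quat_frame_rot: "quat_frame v\<^sub>1 v\<^sub>2 v\<^sub>3 \<Longrightarrow> quat_frame v\<^sub>2 v\<^sub>3 v\<^sub>1"
  unfolding quat_frame_def by blast

lemma quat_frameI:
  assumes "v\<^sub>1 \<in> Im_quat" "v\<^sub>2 \<in> Im_quat" "norm v\<^sub>1 = 1" "norm v\<^sub>2 = 1" "orthogonal v\<^sub>1 v\<^sub>2"
  shows "quat_frame v\<^sub>1 v\<^sub>2 (v\<^sub>1 * v\<^sub>2)"
proof -
  have 11: "v\<^sub>1 * v\<^sub>1 = - 1" and 22: "v\<^sub>2 * v\<^sub>2 = - 1"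
    using assms by (simp_all add: Im_square)
  \<comment> \<open>Orthogonal imaginary quaternions anticommute; with the two squares this
    generates the rest of the table.\<close>
  have 21: "v\<^sub>2 * v\<^sub>1 = - (v\<^sub>1 * v\<^sub>2)"
    using Im_anticommute [OF assms(1,2)] assms(5)
    by (simp add: orthogonal_def eq_neg_iff_add_eq_0 add.commute)
  have 12: "v\<^sub>2 * (v\<^sub>1 * v\<^sub>2) = v\<^sub>1" "v\<^sub>1 * (v\<^sub>1 * v\<^sub>2) = - v\<^sub>2" "(v\<^sub>1 * v\<^sub>2) * v\<^sub>2 = - v\<^sub>1"
  proof -
    have "v\<^sub>2 * (v\<^sub>1 * v\<^sub>2) = v\<^sub>2 * v\<^sub>1 * v\<^sub>2" "v\<^sub>1 * (v\<^sub>1 * v\<^sub>2) = v\<^sub>1 * v\<^sub>1 * v\<^sub>2" by (simp_all only: mult.assoc)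
    then show "v\<^sub>2 * (v\<^sub>1 * v\<^sub>2) = v\<^sub>1" "v\<^sub>1 * (v\<^sub>1 * v\<^sub>2) = - v\<^sub>2" by (simp_all add: 11 21 22 mult.assoc)
    show "(v\<^sub>1 * v\<^sub>2) * v\<^sub>2 = - v\<^sub>1" by (simp add: 22 mult.assoc)
  qed
  moreover have "(v\<^sub>1 * v\<^sub>2) * v\<^sub>1 = v\<^sub>2"
    using 12 by (simp add: mult.assoc 21)
  ultimately have 23: "v\<^sub>2 * (v\<^sub>1 * v\<^sub>2) = v\<^sub>1" "v\<^sub>1 * (v\<^sub>1 * v\<^sub>2) = - v\<^sub>2" "(v\<^sub>1 * v\<^sub>2) * v\<^sub>2 = - v\<^sub>1"
    "(v\<^sub>1 * v\<^sub>2) * v\<^sub>1 = v\<^sub>2" by blast+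
  have "qcnj (v\<^sub>1 * v\<^sub>2) = - (v\<^sub>1 * v\<^sub>2)"
    using assms 21 by (simp add: qcnj_Im)
  then have "v\<^sub>1 * v\<^sub>2 \<in> Im_quat" by (simp add: Im_quat_iff_qcnj)
  moreover have "(v\<^sub>1 * v\<^sub>2) * (v\<^sub>1 * v\<^sub>2) = - 1"
    using 23(1) 11 by (simp add: mult.assoc)
  ultimately show ?thesis
    using assms 11 22 21 23 by (simp add: quat_frame_def)
qed

lemma Im_orth_anticommute: "x \<in> Im_quat \<Longrightarrow> y \<in> Im_quat \<Longrightarrow> x \<bullet> y = 0 \<Longrightarrow> x * y = - (y * x)"
  using Im_anticommute [of x y] by (simp add: eq_neg_iff_add_eq_0)

text \<open>An imaginary quaternion orthogonal to \<open>v\<^sub>1\<close> and \<open>v\<^sub>2\<close> anticommutes with both, hence commutes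
  with \<open>v\<^sub>3 = v\<^sub>1 v\<^sub>2\<close>; being orthogonal to \<open>v\<^sub>3\<close> it also anticommutes with it.\<close>

lemma quat_frame_eq_0:
  assumes "quat_frame v\<^sub>1 v\<^sub>2 v\<^sub>3" and "1 \<bullet> x = 0" "v\<^sub>1 \<bullet> x = 0" "v\<^sub>2 \<bullet> x = 0" "v\<^sub>3 \<bullet> x = 0"
  shows "x = 0"
proof -
  have x: "x \<in> Im_quat" using assms(2) by (simp add: inner_one_quat Im_quat_def)
  have a: "v\<^sub>1 * x = - (x * v\<^sub>1)" "v\<^sub>2 * x = - (x * v\<^sub>2)" "v\<^sub>3 * x = - (x * v\<^sub>3)"
    using assms x Im_orth_anticommute by (auto simp: quat_frame_def)
  have v3: "v\<^sub>3 = v\<^sub>1 * v\<^sub>2" "v\<^sub>3 * v\<^sub>3 = - 1" using assms(1) by (auto simp: quat_frame_def)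
  have "v\<^sub>3 * x = v\<^sub>1 * (v\<^sub>2 * x)" by (simp add: v3 mult.assoc)
  also have "\<dots> = - (v\<^sub>1 * x * v\<^sub>2)" by (simp only: a(2) mult.assoc mult_minus_right)
  also have "\<dots> = x * v\<^sub>1 * v\<^sub>2" by (simp add: a)
  also have "\<dots> = x * v\<^sub>3" by (simp add: v3 mult.assoc)
  finally have "x * v\<^sub>3 = - (x * v\<^sub>3)" using a(3) by simp
  then have "2 *\<^sub>R (x * v\<^sub>3) = 0" by (metis add.right_inverse scaleR_2)
  then show ?thesis using v3 by auto
qed

lemma quat_frame_orth:
  assumes "quat_frame v\<^sub>1 v\<^sub>2 v\<^sub>3"
  shows "1 \<bullet> v\<^sub>1 = 0" "v\<^sub>1 \<bullet> v\<^sub>2 = 0" "v\<^sub>2 \<bullet> v\<^sub>3 = 0" "v\<^sub>3 \<bullet> v\<^sub>1 = 0" "v\<^sub>1 \<bullet> v\<^sub>1 = 1"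
proof -
  have im: "v\<^sub>1 \<in> Im_quat" "v\<^sub>2 \<in> Im_quat" "v\<^sub>3 \<in> Im_quat" using assms by (auto simp: quat_frame_def)
  then show "1 \<bullet> v\<^sub>1 = 0" by (simp add: inner_one_quat Im_quat_def)
  \<comment> \<open>Inner products become real parts of products, which the multiplication table
    supplies.\<close>
  have inn: "x \<bullet> y = - q_re (x * y)" if "x \<in> Im_quat" for x y
    using that by (simp add: inner_quat_def Im_quat_def)
  show "v\<^sub>1 \<bullet> v\<^sub>2 = 0" "v\<^sub>2 \<bullet> v\<^sub>3 = 0" "v\<^sub>3 \<bullet> v\<^sub>1 = 0" "v\<^sub>1 \<bullet> v\<^sub>1 = 1"
    unfolding inn [OF im(1)] inn [OF im(2)] inn [OF im(3)]
    using assms by (auto simp: quat_frame_def Im_quat_def simp del: quat_mult_simps)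
qed

lemma pol_infinity: "pol (1, 0) x = snd x"
  by (simp add: pol_def)

section \<open>Generic parameters\<close>

lemma infinite_quad_nonzero:
  fixes a b c :: real
  assumes "a \<noteq> 0"
  shows "infinite {x \<in> {0<..<1}. quad x a b c \<noteq> 0}"
proof
  assume "finite {x \<in> {0<..<1}. quad x a b c \<noteq> 0}"
  then have "infinite ({0<..<1} - {x \<in> {0<..<1}. quad x a b c \<noteq> 0})"
    by (rule Diff_infinite_finite) simp
  then have "a = 0"
    by (rule quad_vanish(1)) auto
  with assms show False by contradiction
qed

lemma generic_finite:
  assumes "multiaffine P" "t \<in> {0..1}" "u \<in> {0..1}" "snd (P 0 t u) \<noteq> 0"
  shows "infinite {s \<in> {0<..<1}. snd (P s t u) \<noteq> 0}"
proof -
  have *: "snd (P s t u) = lin s (snd (P 0 t u)) (snd (P 1 t u))" if "s \<in> {0<..<1}" for s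
  proof -
    have "s \<in> {0..1}" using that by auto
    from arg_cong [OF multiaffineD(1) [OF assms(1) this assms(2,3)], of snd]
    show ?thesis by (simp only: snd_lin)
  qed
  have "{s \<in> {0<..<1}. snd (P s t u) \<noteq> 0} = {s \<in> {0<..<1}. lin s (snd (P 0 t u)) (snd (P 1 t u)) \<noteq> 0}"
    by (intro Collect_cong conj_cong refl arg_cong [where f = "\<lambda>x. x \<noteq> 0"] *)
  then show ?thesis using infinite_lin_nonzero [OF assms(4)] by simp
qed

lemma snd_at_edge:
  assumes "multiaffine P" "P 0 0 0 = (1, 0)" "t \<in> {0<..<1}"
  shows "snd (P 0 t 0) = t *\<^sub>R snd (P 0 1 0)" "snd (P 0 0 t) = t *\<^sub>R snd (P 0 0 1)"
  using multiaffineD(2) [OF assms(1), of 0 t 0] multiaffineD(3) [OF assms(1), of 0 0 t] assms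
  by (simp_all add: lin_def)

definition edges_along :: "(real \<Rightarrow> real \<Rightarrow> real \<Rightarrow> quat \<times> quat) \<Rightarrow> quat \<Rightarrow> bool" where
  "edges_along P v \<longleftrightarrow> (\<forall>t\<in>{0..1}. \<forall>u\<in>{0..1}. \<exists>f. edge P t u = f *\<^sub>R v)"

lemma edges_along_orth:
  "edges_along P v \<Longrightarrow> e \<bullet> v = 0 \<Longrightarrow> t \<in> {0..1} \<Longrightarrow> u \<in> {0..1} \<Longrightarrow> e \<bullet> edge P t u = 0"
  unfolding edges_along_def by (metis inner_scaleR_right mult_zero_right)

text \<open>With the corner \<open>(1, 0)\<close> the polar form reads off weights, so the unknown
  weight enters the middle coefficients \<open>A\<close> and \<open>B\<close> of the two edge forms
  additively. As \<open>A Q\<close> and \<open>B Q\<close> lie along \<open>v\<^sub>1\<close> and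
  \<open>v\<^sub>2\<close>, orthogonality of \<open>A P\<close> and \<open>B P\<close> leaves only
  the square of the difference.\<close>

lemma face_determined:
  assumes P: "multiaffine P" "isotropic P" "orth12 P"
    and Q: "multiaffine Q" "isotropic Q" "edges_along Q v\<^sub>1" "edges_along (rot Q) v\<^sub>2"
    and frame: "quat_frame v\<^sub>1 v\<^sub>2 v\<^sub>3"
    and c: "P 0 0 0 = (1, 0)" "Q 0 0 0 = (1, 0)" "P 1 0 0 = Q 1 0 0" "P 0 1 0 = Q 0 1 0"
      "snd (Q 1 0 0) \<noteq> 0" "snd (Q 0 1 0) \<noteq> 0"
  shows "snd (P 1 1 0) = snd (Q 1 1 0)"
proof -
  define \<delta> where "\<delta> = snd (P 1 1 0) - snd (Q 1 1 0)"
  define A where "A R = pol (R 0 0 0) (R 1 1 0) + pol (R 0 1 0) (R 1 0 0)" for R :: "real \<Rightarrow> real \<Rightarrow> real \<Rightarrow> quat \<times> quat"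
  define B where "B R = pol (R 0 0 0) (R 1 1 0) + pol (R 1 0 0) (R 0 1 0)" for R :: "real \<Rightarrow> real \<Rightarrow> real \<Rightarrow> quat \<times> quat"
  have AP: "A P = A Q + \<delta>" and BP: "B P = B Q + \<delta>"
    by (simp_all add: A_def B_def c pol_infinity \<delta>_def)
  note rots = multiaffine_rot [OF P(1)] multiaffine_rot [OF Q(1)]
  \<comment> \<open>For fixed \<open>t\<close> orthogonality is a quadratic identity in
    \<open>s\<close>, valid for infinitely many \<open>s\<close>; its constant and middle
    coefficients are kept.\<close>
  have E: "edge P t 0 \<bullet> edge (rot P) 0 0 = 0" "edge P t 0 \<bullet> B P = 0" if "t \<in> {0<..<1}" for t
  proof -
    let ?S = "{s \<in> {0<..<1}. snd (P s t 0) \<noteq> 0}"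
    have t: "t \<in> {0..1}" using that by auto
    have "infinite ?S"
      using generic_finite [OF P(1) t, of 0] snd_at_edge(1) [OF P(1) c(1) that] c that by simp
    moreover have "edge P t 0 \<bullet> edge (rot P) 0 s = 0" if "s \<in> ?S" for s
    proof -
      have "s \<in> {0..1}" "snd (P s t 0) \<noteq> 0" using that by auto
      with P(3) t show ?thesis unfolding orth12_def by (metis atLeastAtMost_iff order_refl zero_le_one)
    qed
    moreover have "?S \<subseteq> {0..1}" by auto
    ultimately show "edge P t 0 \<bullet> edge (rot P) 0 0 = 0" "edge P t 0 \<bullet> B P = 0"
      using edge_middle_orth' [OF rots(1), of ?S 0 "edge P t 0"] by (simp_all add: B_def rot_def)
  qed
  have e1: "edge P 0 0 = snd (Q 1 0 0)" "edge Q 0 0 = snd (Q 1 0 0)"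
    and e2: "edge (rot P) 0 0 = snd (Q 0 1 0)" "edge (rot Q) 0 0 = snd (Q 0 1 0)"
    by (simp_all add: edge_def rot_def c pol_infinity)
  obtain f where f: "snd (Q 1 0 0) = f *\<^sub>R v\<^sub>1" using Q(3) e1 by (metis edges_along_def atLeastAtMost_iff order_refl zero_le_one)
  obtain g where g: "snd (Q 0 1 0) = g *\<^sub>R v\<^sub>2" using Q(4) e2 by (metis edges_along_def atLeastAtMost_iff order_refl zero_le_one)
  have "f \<noteq> 0" "g \<noteq> 0" using f g c by auto
  \<comment> \<open>The same comparison in \<open>t\<close> against the fixed vector
    \<open>B P\<close>: the constant coefficient is a nonzero multiple of \<open>v\<^sub>1\<close>,
    the middle one is \<open>A P\<close>.\<close>
  have B1: "v\<^sub>1 \<bullet> B P = 0" and AB: "B P \<bullet> A P = 0"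
    using edge_middle_orth [OF P(1), of "{0<..<1}" "B P"] E(2) e1 f \<open>f \<noteq> 0\<close>
    by (simp_all add: A_def inner_commute)
  have A2: "v\<^sub>2 \<bullet> A P = 0"
    using edge_middle_orth [OF P(1), of "{0<..<1}" "v\<^sub>2"] E(1) e2 g \<open>g \<noteq> 0\<close>
    by (simp add: A_def inner_commute)
  \<comment> \<open>That \<open>A Q\<close> lies along \<open>v\<^sub>1\<close>, and below
    \<open>B Q\<close> along \<open>v\<^sub>2\<close>, is used in the form of orthogonality to all
    vectors orthogonal to these.\<close>
  have AQ: "e \<bullet> A Q = 0" if "e \<bullet> v\<^sub>1 = 0" for e
    using edge_middle_orth(2) [OF Q(1), of "{0<..<1}" e] edges_along_orth [OF Q(3) that]
    by (simp add: A_def)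
  have BQ: "e \<bullet> B Q = 0" if "e \<bullet> v\<^sub>2 = 0" for e
    using edge_middle_orth'(2) [OF rots(2), of "{0<..<1}" 0 e] edges_along_orth [OF Q(4) that]
    by (simp add: B_def rot_def)
  have "v\<^sub>1 \<bullet> \<delta> = 0" "v\<^sub>2 \<bullet> \<delta> = 0"
    using A2 B1 AQ [of "v\<^sub>2"] BQ [of "v\<^sub>1"] quat_frame_orth [OF frame]
    by (simp_all add: AP BP inner_add_right inner_commute)
  then have "\<delta> \<bullet> A Q = 0" "\<delta> \<bullet> B Q = 0" using AQ BQ by (simp_all add: inner_commute)
  moreover have "B Q \<bullet> A Q = 0"
    using BQ [of "A Q"] AQ [of "v\<^sub>2"] quat_frame_orth [OF frame] by (simp add: inner_commute)
  ultimately have "\<delta> \<bullet> \<delta> = 0"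
    using AB by (simp add: AP BP inner_add_left inner_add_right inner_commute)
  then show ?thesis by (simp add: \<delta>_def)
qed

text \<open>The unknown last weight enters \<open>edge_centre\<close> additively. Isotropy kills the
  real part. On the face \<open>s = 0\<close> the form of the \<open>t\<close> direction is common
  to both nets and lies along \<open>v\<^sub>2\<close>, so orthogonality to it makes all of
  \<open>edge P\<close> orthogonal to \<open>v\<^sub>2\<close>.\<close>

lemma centre_determined:
  assumes P: "multiaffine P" "isotropic P" "orth12 P"
    and Q: "multiaffine Q" "isotropic Q" "edges_along Q v\<^sub>1" "edges_along (rot Q) v\<^sub>2"
    and frame: "quat_frame v\<^sub>1 v\<^sub>2 v\<^sub>3"
    and c: "P 0 0 0 = (1, 0)" "Q 0 0 0 = (1, 0)" "P 1 0 0 = Q 1 0 0" "P 0 1 0 = Q 0 1 0"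
      "P 0 0 1 = Q 0 0 1" "P 1 1 0 = Q 1 1 0" "P 0 1 1 = Q 0 1 1" "P 1 0 1 = Q 1 0 1"
      "snd (Q 0 0 1) \<noteq> 0" "snd (Q 0 1 0) \<noteq> 0"
  shows "1 \<bullet> (snd (P 1 1 1) - snd (Q 1 1 1)) = 0" "v\<^sub>2 \<bullet> (snd (P 1 1 1) - snd (Q 1 1 1)) = 0"
proof -
  have cent: "edge_centre P = edge_centre Q + (snd (P 1 1 1) - snd (Q 1 1 1))"
    by (simp add: edge_centre_def c pol_infinity)
  have re: "1 \<bullet> edge_centre R = 0" if "multiaffine R" "isotropic R" for R
    by (rule edge_centre_orth [where S = "{0<..<1}" and T = "\<lambda>_. {0<..<1}"])
      (use that isotropic_edge_Re in auto)
  from re [OF P(1,2)] re [OF Q(1,2)] show "1 \<bullet> (snd (P 1 1 1) - snd (Q 1 1 1)) = 0"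
    by (simp add: cent inner_add_right)
  have "v\<^sub>2 \<bullet> edge_centre Q = 0"
    by (rule edge_centre_orth [where S = "{0<..<1}" and T = "\<lambda>_. {0<..<1}"])
      (use Q edges_along_orth quat_frame_orth [OF frame] in \<open>auto simp: inner_commute\<close>)
  moreover
  \<comment> \<open>For \<open>u\<close> in \<open>S\<close> the form on the common face is nonzero;
    for \<open>t\<close> in \<open>T u\<close> the map is finite at \<open>s = 0\<close>, hence at
    infinitely many \<open>s\<close>.\<close>
  define S where "S = {u \<in> {0<..<1}. v\<^sub>2 \<bullet> edge (rot Q) u 0 \<noteq> 0}"
  define T where "T u = {t \<in> {0<..<1}. snd (P 0 t u) \<noteq> 0}" for u
  note rots = multiaffine_rot [OF P(1)] multiaffine_rot [OF Q(1)]
  have "edge (rot Q) 0 0 = snd (Q 0 1 0)"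
    by (simp add: edge_def rot_def c pol_infinity)
  then obtain g where g: "snd (Q 0 1 0) = g *\<^sub>R v\<^sub>2"
    using Q(4) by (metis edges_along_def atLeastAtMost_iff order_refl zero_le_one)
  have S: "infinite S"
  proof -
    let ?b = "v\<^sub>2 \<bullet> (pol (rot Q 0 0 0) (rot Q 1 1 0) + pol (rot Q 0 1 0) (rot Q 1 0 0))"
    have *: "v\<^sub>2 \<bullet> edge (rot Q) u 0 = quad u (v\<^sub>2 \<bullet> edge (rot Q) 0 0) ?b (v\<^sub>2 \<bullet> edge (rot Q) 1 0)"
      if "u \<in> {0<..<1}" for u
      using edge_quad_1 [OF rots(2), of u 0] that by (simp flip: inner_quad)
    have "S = {u \<in> {0<..<1}. quad u (v\<^sub>2 \<bullet> edge (rot Q) 0 0) ?b (v\<^sub>2 \<bullet> edge (rot Q) 1 0) \<noteq> 0}"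
      unfolding S_def by (intro Collect_cong conj_cong refl arg_cong [where f = "\<lambda>x. x \<noteq> 0"] *)
    moreover have "v\<^sub>2 \<bullet> edge (rot Q) 0 0 \<noteq> 0"
      using g c(10) quat_frame_orth(5) [OF quat_frame_rot [OF frame]] \<open>edge (rot Q) 0 0 = snd (Q 0 1 0)\<close> by auto
    ultimately show ?thesis using infinite_quad_nonzero by presburger
  qed
  have T: "infinite (T u)" if "u \<in> S" for u
  proof -
    have u: "u \<in> {0<..<1}" "u \<in> {0..1}" using that by (auto simp: S_def)
    have *: "snd (P 0 t u) = lin t (snd (P 0 0 u)) (snd (P 0 1 u))" if "t \<in> {0<..<1}" for t
      using multiaffineD(2) [OF P(1), of 0 t u] that u by simp
    have "T u = {t \<in> {0<..<1}. lin t (snd (P 0 0 u)) (snd (P 0 1 u)) \<noteq> 0}"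
      unfolding T_def by (intro Collect_cong conj_cong refl arg_cong [where f = "\<lambda>x. x \<noteq> 0"] *)
    moreover have "snd (P 0 0 u) \<noteq> 0"
      using snd_at_edge(2) [OF P(1) c(1) u(1)] c u by simp
    ultimately show ?thesis
      using infinite_lin_nonzero [of "snd (P 0 0 u)" "snd (P 0 1 u)"] by simp
  qed
  have "v\<^sub>2 \<bullet> edge P t u = 0" if u: "u \<in> S" and t: "t \<in> T u" for t u
  proof -
    let ?S = "{s \<in> {0<..<1}. snd (P s t u) \<noteq> 0}"
    have tu: "t \<in> {0..1}" "u \<in> {0..1}" "snd (P 0 t u) \<noteq> 0" using u t by (auto simp: S_def T_def)
    have "edge P t u \<bullet> edge (rot P) u s = 0" if "s \<in> ?S" for s
    proof -
      have "s \<in> {0..1}" "snd (P s t u) \<noteq> 0" using that by auto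
      with P(3) tu show ?thesis unfolding orth12_def by blast
    qed
    \<comment> \<open>The constant Bernstein coefficient in \<open>s\<close> is the value on the
      face \<open>s = 0\<close>, where only corners shared with \<open>Q\<close> enter.\<close>
    then have "edge P t u \<bullet> edge (rot P) u 0 = 0"
      by (intro edge_middle_orth'(1) [OF rots(1) generic_finite [OF P(1) tu] _ tu(2)]) auto
    moreover have "edge (rot P) u 0 = edge (rot Q) u 0"
      using multiaffineD(3) [OF P(1), of 0 0 u] multiaffineD(3) [OF P(1), of 0 1 u]
        multiaffineD(3) [OF Q(1), of 0 0 u] multiaffineD(3) [OF Q(1), of 0 1 u] tu
      by (simp add: edge_def rot_def c)
    moreover obtain f where "edge (rot Q) u 0 = f *\<^sub>R v\<^sub>2"
      using Q(4) tu by (metis edges_along_def atLeastAtMost_iff order_refl zero_le_one)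
    moreover have "v\<^sub>2 \<bullet> edge (rot Q) u 0 \<noteq> 0" using u by (simp add: S_def)
    ultimately show ?thesis by (auto simp: inner_commute)
  qed
  then have "v\<^sub>2 \<bullet> edge_centre P = 0"
    using T by (intro edge_centre_orth [where S = S and T = T, OF P(1) S]) (auto simp: S_def T_def)
  ultimately show "v\<^sub>2 \<bullet> (snd (P 1 1 1) - snd (Q 1 1 1)) = 0"
    by (simp add: cent inner_add_right)
qed

section \<open>Partial derivatives of quaternionic fractions\<close>

lemma has_vector_derivative_lin:
  fixes a b :: "'a::real_normed_vector"
  shows "((\<lambda>x. lin x a b) has_vector_derivative (b - a)) (at x within S)"
  unfolding lin_def by (auto intro!: derivative_eq_intros)

text \<open>With \<open>q = U W\<^sup>-\<^sup>1\<close> imaginary, \<open>q = - q\<^sup>*\<close> turns \<open>(U' - q W') W\<^sup>-\<^sup>1\<close> into a conjugate of the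
  polar form.\<close>

lemma vector_derivative_qfrac:
  fixes f :: "real \<Rightarrow> quat option" and a b :: "quat \<times> quat" and s :: real
  defines "w \<equiv> snd (lin s a b)"
  assumes f: "\<And>x. x \<in> {0..1} \<Longrightarrow> f x = qfrac (fst (lin x a b)) (snd (lin x a b))"
    and s: "s \<in> {0..1}" "w \<noteq> 0"
    and iso: "\<And>x. x \<in> {0..1} \<Longrightarrow> pol (lin x a b) (lin x a b) = 0"
  shows "vector_derivative (\<lambda>x. the (f x)) (at s within {0..1}) = inverse (qcnj w) * pol a b * inverse w"
proof -
  let ?U = "\<lambda>x. lin x (fst a) (fst b)" and ?W = "\<lambda>x. lin x (snd a) (snd b)"
  let ?U' = "fst b - fst a" and ?W' = "snd b - snd a"
  have w: "?W s = w" by (simp add: w_def)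
  have aa: "pol a a = 0" and bb: "pol b b = 0" using iso [of 0] iso [of 1] by simp_all
  then have ba: "pol b a = - pol a b"
    using iso [of "1/2"] by (simp add: pol_lin quad_def eq_neg_iff_add_eq_0 add.commute)
  \<comment> \<open>The squares of the ends vanish and the two mixed terms are opposite, so the
    factors \<open>1 - s\<close> and \<open>s\<close> add up to 1 and the dependence on
    \<open>s\<close> disappears.\<close>
  have p: "pol (lin s a b) (b - a) = pol a b"
  proof -
    have "pol (lin s a b) (b - a) = (1 - s) *\<^sub>R (pol a b - pol a a) + s *\<^sub>R (pol b b - pol b a)"
      by (simp add: lin_def pol_def algebra_simps)
    then show ?thesis by (simp add: aa bb ba algebra_simps)
  qed
  have "qcnj w * ?U s + qcnj (?U s) * w = 0"
    using iso [OF s(1)] by (simp add: pol_def w)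
  then have "inverse (qcnj w) * (qcnj w * ?U s + qcnj (?U s) * w) * inverse w = 0" by simp
  moreover have "inverse (qcnj w) * (qcnj w * ?U s) = ?U s" "(qcnj (?U s) * w) * inverse w = qcnj (?U s)"
    using s(2) by (simp_all flip: mult.assoc) (simp add: mult.assoc)
  ultimately have "?U s * inverse w + inverse (qcnj w) * qcnj (?U s) = 0"
    by (simp only: distrib_left distrib_right mult.assoc)
  then have q: "?U s * inverse w = - (inverse (qcnj w) * qcnj (?U s))"
    by (simp add: eq_neg_iff_add_eq_0)
  have dU: "(?U has_vector_derivative ?U') (at s within {0..1})"
    and dW: "(?W has_vector_derivative ?W') (at s within {0..1})"
    by (rule has_vector_derivative_lin)+
  from dW have "(?W has_derivative (\<lambda>h. h *\<^sub>R ?W')) (at s within {0..1})"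
    by (simp add: has_vector_derivative_def)
  from has_derivative_compose [OF this has_derivative_inverse' [of "?W s"]] s(2)
  have "((\<lambda>x. inverse (?W x)) has_derivative (\<lambda>h. - (inverse w * (h *\<^sub>R ?W') * inverse w)))
    (at s within {0..1})" by (simp add: w)
  then have "((\<lambda>x. inverse (?W x)) has_vector_derivative - (inverse w * ?W' * inverse w))
    (at s within {0..1})" by (simp add: has_vector_derivative_def)
  from has_vector_derivative_mult [OF dU this]
  have "((\<lambda>x. ?U x * inverse (?W x)) has_vector_derivative
      ?U s * (- (inverse w * ?W' * inverse w)) + ?U' * inverse w) (at s within {0..1})"
    by (simp only: w)
  moreover have "?U s * (- (inverse w * ?W' * inverse w)) + ?U' * inverse w = inverse (qcnj w) * pol a b * inverse w"
  proof -
    have "?U s * (- (inverse w * ?W' * inverse w)) = - (?U s * inverse w) * ?W' * inverse w"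
      by (simp add: mult.assoc)
    also have "\<dots> = inverse (qcnj w) * (qcnj (?U s) * ?W') * inverse w"
      unfolding q by (simp add: mult.assoc)
    finally have 1: "?U s * (- (inverse w * ?W' * inverse w)) = inverse (qcnj w) * (qcnj (?U s) * ?W') * inverse w" .
    have 2: "?U' * inverse w = inverse (qcnj w) * (qcnj w * ?U') * inverse w"
      using s(2) by (simp flip: mult.assoc)
    have "pol a b = qcnj w * ?U' + qcnj (?U s) * ?W'"
      unfolding p [symmetric] by (simp add: pol_def w)
    then show ?thesis unfolding 1 2 by (simp only: distrib_left distrib_right add.commute)
  qed
  ultimately have D: "((\<lambda>x. ?U x * inverse (?W x)) has_vector_derivative inverse (qcnj w) * pol a b * inverse w)
    (at s within {0..1})" by simp
  \<comment> \<open>Near \<open>s\<close> the denominator stays nonzero, so the unspecified value of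
    \<open>the\<close> at infinity does not affect the derivative.\<close>
  have "isCont ?W s" unfolding lin_def by (intro continuous_intros)
  then have "\<forall>\<^sub>F x in at s. ?W x \<noteq> 0"
    using s(2) w by (intro tendsto_imp_eventually_ne [of _ w]) (auto simp: isCont_def)
  then obtain d where d: "d > 0" "\<And>x. x \<noteq> s \<Longrightarrow> dist x s < d \<Longrightarrow> ?W x \<noteq> 0"
    unfolding eventually_at by auto
  have "((\<lambda>x. the (f x)) has_vector_derivative inverse (qcnj w) * pol a b * inverse w) (at s within {0..1})"
  proof (rule has_vector_derivative_transform_within [OF D d(1) s(1)])
    fix x :: real assume "x \<in> {0..1}" "dist x s < d"
    then show "?U x * inverse (?W x) = the (f x)"
      using d(2) [of x] s(2) w f [of x] by (cases "x = s") (auto simp: qfrac_def)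
  qed
  moreover have "at s within {0..1} \<noteq> bot"
    using s(1) islimpt_Icc [of 0 1 s] by (simp add: trivial_limit_within)
  ultimately show ?thesis by (intro vector_derivative_within)
qed

text \<open>For \<open>W \<noteq> 0\<close> the inverse of \<open>W\<close> is a positive multiple
  of its conjugate, and the polar form is twice the real part of \<open>U * qcnj W\<close>. For
  \<open>W = 0\<close> the polar form vanishes, in agreement with the value at infinity.\<close>

lemma qfrac_in_ext_R3_iff: "qfrac U W \<in> ext_R3 \<longleftrightarrow> pol (U, W) (U, W) = 0"
proof (cases "W = 0")
  case True
  then show ?thesis by (simp add: qfrac_def ext_R3_def pol_def)
next
  case False
  then have n: "(norm W)\<^sup>2 \<noteq> 0" by simp
  have inv: "inverse W = (1 / (norm W)\<^sup>2) *\<^sub>R qcnj W"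
    using inverse_qcnj [of "qcnj W"] by simp
  have "pol (U, W) (U, W) = of_real (2 * q_re (U * qcnj W))"
    by (simp add: pol_def quat_eq_iff of_real_def)
  then have "pol (U, W) (U, W) = 0 \<longleftrightarrow> q_re (U * qcnj W) = 0"
    by (simp del: quat_mult_simps)
  moreover have "U * inverse W \<in> Im_quat \<longleftrightarrow> q_re (U * qcnj W) = 0"
    using n unfolding inv Im_quat_def by (simp del: quat_mult_simps)
  ultimately show ?thesis
    using False by (auto simp: qfrac_def ext_R3_def)
qed

definition net_map :: "(real \<Rightarrow> real \<Rightarrow> real \<Rightarrow> quat \<times> quat) \<Rightarrow> real \<Rightarrow> real \<Rightarrow> real \<Rightarrow> quat option" where
  "net_map P s t u = qfrac (fst (P s t u)) (snd (P s t u))"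

lemma net_map_eq_None_iff: "net_map P s t u = None \<longleftrightarrow> snd (P s t u) = 0"
  by (simp add: net_map_def qfrac_def)

lemma isotropic_iff_net_map:
  "isotropic P \<longleftrightarrow> (\<forall>s\<in>{0..1}. \<forall>t\<in>{0..1}. \<forall>u\<in>{0..1}. net_map P s t u \<in> ext_R3)"
  by (simp add: isotropic_def net_map_def qfrac_in_ext_R3_iff)

lemma partial_derivatives:
  assumes P: "multiaffine P" "isotropic P"
    and F': "\<forall>s\<in>{0..1}. \<forall>t\<in>{0..1}. \<forall>u\<in>{0..1}. F s t u = net_map P s t u"
    and stu: "s \<in> {0..1}" "t \<in> {0..1}" "u \<in> {0..1}" and w: "snd (P s t u) \<noteq> 0"
  defines "w \<equiv> snd (P s t u)"
  shows "deriv_s F s t u = inverse (qcnj w) * edge P t u * inverse w"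
    "deriv_t F s t u = inverse (qcnj w) * edge (rot P) u s * inverse w"
    "deriv_u F s t u = inverse (qcnj w) * edge (rot (rot P)) s t * inverse w"
proof -
  have F: "F s t u = net_map P s t u" if "s \<in> {0..1}" "t \<in> {0..1}" "u \<in> {0..1}" for s t u
    using F' that by blast
  have 1: "P x t u = lin x (P 0 t u) (P 1 t u)" if "x \<in> {0..1}" for x
    using multiaffineD(1) [OF P(1) that stu(2,3)] .
  have 2: "P s x u = lin x (P s 0 u) (P s 1 u)" if "x \<in> {0..1}" for x
    using multiaffineD(2) [OF P(1) stu(1) that stu(3)] .
  have 3: "P s t x = lin x (P s t 0) (P s t 1)" if "x \<in> {0..1}" for x
    using multiaffineD(3) [OF P(1) stu(1,2) that] .
  have iso: "pol (P x y z) (P x y z) = 0" if "x \<in> {0..1}" "y \<in> {0..1}" "z \<in> {0..1}" for x y z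
    using P(2) that unfolding isotropic_def by blast
  show "deriv_s F s t u = inverse (qcnj w) * edge P t u * inverse w"
    unfolding deriv_s_def edge_def w_def 1 [OF stu(1)]
  proof (rule vector_derivative_qfrac)
    fix x :: real assume x: "x \<in> {0..1}"
    show "F x t u = qfrac (fst (lin x (P 0 t u) (P 1 t u))) (snd (lin x (P 0 t u) (P 1 t u)))"
      using F [OF x stu(2,3)] unfolding net_map_def 1 [OF x] .
    show "pol (lin x (P 0 t u) (P 1 t u)) (lin x (P 0 t u) (P 1 t u)) = 0"
      using iso [OF x stu(2,3)] unfolding 1 [OF x] .
  qed (use stu w 1 [OF stu(1)] in metis)+
  show "deriv_t F s t u = inverse (qcnj w) * edge (rot P) u s * inverse w"
    unfolding deriv_t_def edge_def rot_def w_def 2 [OF stu(2)]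
  proof (rule vector_derivative_qfrac)
    fix x :: real assume x: "x \<in> {0..1}"
    show "F s x u = qfrac (fst (lin x (P s 0 u) (P s 1 u))) (snd (lin x (P s 0 u) (P s 1 u)))"
      using F [OF stu(1) x stu(3)] unfolding net_map_def 2 [OF x] .
    show "pol (lin x (P s 0 u) (P s 1 u)) (lin x (P s 0 u) (P s 1 u)) = 0"
      using iso [OF stu(1) x stu(3)] unfolding 2 [OF x] .
  qed (use stu w 2 [OF stu(2)] in metis)+
  show "deriv_u F s t u = inverse (qcnj w) * edge (rot (rot P)) s t * inverse w"
    unfolding deriv_u_def edge_def rot_def w_def 3 [OF stu(3)]
  proof (rule vector_derivative_qfrac)
    fix x :: real assume x: "x \<in> {0..1}"
    show "F s t x = qfrac (fst (lin x (P s t 0) (P s t 1))) (snd (lin x (P s t 0) (P s t 1)))"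
      using F [OF stu(1,2) x] unfolding net_map_def 3 [OF x] .
    show "pol (lin x (P s t 0) (P s t 1)) (lin x (P s t 0) (P s t 1)) = 0"
      using iso [OF stu(1,2) x] unfolding 3 [OF x] .
  qed (use stu w 3 [OF stu(3)] in metis)+
qed

text \<open>Left and right multiplications are similarities, so the factors around the edge forms in
  the derivatives rescale all inner products alike.\<close>

lemma inner_conjugate:
  "(inverse (qcnj w) * x * inverse w) \<bullet> (inverse (qcnj w) * y * inverse w) = (x \<bullet> y) / norm w ^ 4"
proof -
  have inn: "(c * x * d) \<bullet> (c * y * d) = (norm c)\<^sup>2 * (norm d)\<^sup>2 * (x \<bullet> y)" for c d :: quat
  proof -
    have "(c * x) \<bullet> (c * y) = (norm c)\<^sup>2 * (x \<bullet> y)" for x y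
      unfolding norm_power2_quat by (simp add: inner_quat_def algebra_simps power2_eq_square)
    moreover have "(x * d) \<bullet> (y * d) = (norm d)\<^sup>2 * (x \<bullet> y)" for x y
      unfolding norm_power2_quat by (simp add: inner_quat_def algebra_simps power2_eq_square)
    ultimately show ?thesis by simp
  qed
  have "inverse (norm w ^ 4) = inverse ((norm w)\<^sup>2) * inverse ((norm w)\<^sup>2)"
    by (simp flip: inverse_mult_distrib power_add)
  then show ?thesis
    by (simp add: inn norm_inverse divide_inverse power_inverse)
qed

section \<open>Passing between DC cubes and nets\<close>

lemma trilinear_poly_multiaffine:
  assumes "trilinear_poly U"
  shows "multiaffine U"
proof -
  have sum1: "(\<Sum>i\<le>1. g i) = g 0 + g 1" for g :: "nat \<Rightarrow> quat"
    by simp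
  from assms obtain c where c: "\<And>s t u. U s t u = (\<Sum>i\<le>1. \<Sum>j\<le>1. \<Sum>k\<le>1. (s ^ i * t ^ j * u ^ k) *\<^sub>R c i j k)"
    unfolding trilinear_poly_def by blast
  show ?thesis
    unfolding multiaffine_def c sum1 lin_def by (simp add: algebra_simps)
qed

lemma multiaffine_Pair: "multiaffine U \<Longrightarrow> multiaffine W \<Longrightarrow> multiaffine (\<lambda>s t u. (U s t u, W s t u))"
  unfolding multiaffine_def prod_eq_iff fst_lin snd_lin fst_conv snd_conv by blast

lemma DC_cube_net:
  assumes "DC_cube G"
  obtains P where "multiaffine P" "isotropic P" "orth12 P" "orth12 (rot P)" "orth12 (rot (rot P))"
    "\<And>s t u. s \<in> {0..1} \<Longrightarrow> t \<in> {0..1} \<Longrightarrow> u \<in> {0..1} \<Longrightarrow> G s t u = net_map P s t u"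
proof -
  from assms obtain U W where UW: "trilinear_poly U" "trilinear_poly W"
    "\<And>s t u. s \<in> {0..1} \<Longrightarrow> t \<in> {0..1} \<Longrightarrow> u \<in> {0..1} \<Longrightarrow> G s t u = qfrac (U s t u) (W s t u)"
    unfolding DC_cube_def by blast
  define P where "P s t u = (U s t u, W s t u)" for s t u
  have P: "multiaffine P"
    unfolding P_def using UW by (intro multiaffine_Pair trilinear_poly_multiaffine)
  have G: "G s t u = net_map P s t u" if "s \<in> {0..1}" "t \<in> {0..1}" "u \<in> {0..1}" for s t u
    using UW(3) [OF that] by (simp add: net_map_def P_def)
  then have G': "\<forall>s\<in>{0..1}. \<forall>t\<in>{0..1}. \<forall>u\<in>{0..1}. G s t u = net_map P s t u" by blast
  have iso: "isotropic P"
    unfolding isotropic_iff_net_map using assms G unfolding DC_cube_def by metis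
  have orth: "edge P t u \<bullet> edge (rot P) u s = 0 \<and> edge P t u \<bullet> edge (rot (rot P)) s t = 0 \<and>
      edge (rot P) u s \<bullet> edge (rot (rot P)) s t = 0"
    if stu: "s \<in> {0..1}" "t \<in> {0..1}" "u \<in> {0..1}" "snd (P s t u) \<noteq> 0" for s t u
  proof -
    have "G s t u \<noteq> None" using G [OF stu(1-3)] stu(4) by (simp add: net_map_eq_None_iff)
    then have "orthogonal (deriv_s G s t u) (deriv_t G s t u) \<and>
        orthogonal (deriv_s G s t u) (deriv_u G s t u) \<and>
        orthogonal (deriv_t G s t u) (deriv_u G s t u)"
      using assms stu unfolding DC_cube_def by blast
    then show ?thesis
      using stu(4) by (simp add: orthogonal_def partial_derivatives [OF P iso G' stu] inner_conjugate)
  qed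
  show thesis
  proof (rule that [OF P iso _ _ _ G])
    show "orth12 P" unfolding orth12_def using orth by blast
    show "orth12 (rot P)" unfolding orth12_def using orth by (simp add: rot_def [of P _ _ _])
    show "orth12 (rot (rot P))" unfolding orth12_def rot3 using orth
      by (simp add: rot_def [of P _ _ _] rot_def [of "rot P" _ _ _] inner_commute)
  qed
qed

text \<open>The real part of a product of three imaginary quaternions is minus their scalar triple
  product, so the Jacobian can be computed by quaternion multiplication.\<close>

lemma det_im_coords:
  assumes "x \<in> Im_quat" "y \<in> Im_quat" "z \<in> Im_quat"
  shows "det (vector [im_coords x, im_coords y, im_coords z] :: real ^ 3 ^ 3) = - q_re (x * y * z)"
  using assms by (simp add: det_3 im_coords_def Im_quat_def algebra_simps)

text \<open>At each finite point the three derivatives are multiples of the frame vectors surrounded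
  by the same two factors, hence orthogonal. A single finite point with nonzero edge forms settles
  the Jacobian.\<close>

lemma DC_cube_net_map:
  assumes tri: "trilinear_poly (\<lambda>s t u. fst (P s t u))" "trilinear_poly (\<lambda>s t u. snd (P s t u))"
    and iso: "isotropic P" and frame: "quat_frame v\<^sub>1 v\<^sub>2 v\<^sub>3"
    and along: "edges_along P v\<^sub>1" "edges_along (rot P) v\<^sub>2" "edges_along (rot (rot P)) v\<^sub>3"
    and pt: "s\<^sub>0 \<in> {0..1}" "t\<^sub>0 \<in> {0..1}" "u\<^sub>0 \<in> {0..1}" "snd (P s\<^sub>0 t\<^sub>0 u\<^sub>0) \<noteq> 0"
    and nz: "edge P t\<^sub>0 u\<^sub>0 \<noteq> 0" "edge (rot P) u\<^sub>0 s\<^sub>0 \<noteq> 0" "edge (rot (rot P)) s\<^sub>0 t\<^sub>0 \<noteq> 0"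
  shows "DC_cube (net_map P)"
proof -
  have P: "multiaffine P"
    using multiaffine_Pair [OF trilinear_poly_multiaffine [OF tri(1)] trilinear_poly_multiaffine [OF tri(2)]]
    by simp
  have "\<forall>s\<in>{0..1}. \<forall>t\<in>{0..1}. \<forall>u\<in>{0..1}. net_map P s t u = net_map P s t u" by simp
  note pd = partial_derivatives [OF P iso this]
  note fo = quat_frame_orth [OF frame]
  have "orthogonal (deriv_s (net_map P) s t u) (deriv_t (net_map P) s t u) \<and>
        orthogonal (deriv_s (net_map P) s t u) (deriv_u (net_map P) s t u) \<and>
        orthogonal (deriv_t (net_map P) s t u) (deriv_u (net_map P) s t u)"
    if stu: "s \<in> {0..1}" "t \<in> {0..1}" "u \<in> {0..1}" "net_map P s t u \<noteq> None" for s t u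
  proof -
    have w: "snd (P s t u) \<noteq> 0" using stu(4) by (simp add: net_map_eq_None_iff)
    obtain f g h where "edge P t u = f *\<^sub>R v\<^sub>1" "edge (rot P) u s = g *\<^sub>R v\<^sub>2" "edge (rot (rot P)) s t = h *\<^sub>R v\<^sub>3"
      using along stu unfolding edges_along_def by blast
    then show ?thesis
      by (simp add: orthogonal_def pd [OF stu(1-3) w] inner_conjugate fo inner_commute [of v\<^sub>1 v\<^sub>3])
  qed
  moreover have "jacobian (net_map P) s\<^sub>0 t\<^sub>0 u\<^sub>0 \<noteq> 0"
  proof -
    define w where "w = snd (P s\<^sub>0 t\<^sub>0 u\<^sub>0)"
    have w: "w \<noteq> 0" using pt by (simp add: w_def)
    obtain f g h where fgh: "edge P t\<^sub>0 u\<^sub>0 = f *\<^sub>R v\<^sub>1" "edge (rot P) u\<^sub>0 s\<^sub>0 = g *\<^sub>R v\<^sub>2"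
        "edge (rot (rot P)) s\<^sub>0 t\<^sub>0 = h *\<^sub>R v\<^sub>3"
      using along pt unfolding edges_along_def by blast
    then have nz': "f \<noteq> 0" "g \<noteq> 0" "h \<noteq> 0" using nz by auto
    let ?n = "1 / (norm w)\<^sup>2"
    let ?c = "\<lambda>v. w * v * inverse w"
    \<comment> \<open>Since \<open>inverse (qcnj w)\<close> is \<open>w\<close> over its squared
      norm, the derivatives are multiples of the frame rotated by conjugation with
      \<open>w\<close>.\<close>
    have d: "deriv_s (net_map P) s\<^sub>0 t\<^sub>0 u\<^sub>0 = (?n * f) *\<^sub>R ?c v\<^sub>1"
      "deriv_t (net_map P) s\<^sub>0 t\<^sub>0 u\<^sub>0 = (?n * g) *\<^sub>R ?c v\<^sub>2"
      "deriv_u (net_map P) s\<^sub>0 t\<^sub>0 u\<^sub>0 = (?n * h) *\<^sub>R ?c v\<^sub>3"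
      unfolding pd [OF pt] fgh w_def [symmetric] inverse_qcnj by simp_all
    have im: "r *\<^sub>R ?c v \<in> Im_quat" if "v \<in> Im_quat" for v r
    proof -
      have "?c v = ?n *\<^sub>R (w * v * qcnj w)"
        using inverse_qcnj [of "qcnj w"] by simp
      moreover have "w * v * qcnj w \<in> Im_quat"
        using that by (simp only: Im_quat_iff_qcnj qcnj_simps) (simp add: mult.assoc)
      ultimately show ?thesis
        by (simp add: Im_quat_def del: quat_mult_simps)
    qed
    have im_frame: "v\<^sub>1 \<in> Im_quat" "v\<^sub>2 \<in> Im_quat" "v\<^sub>3 \<in> Im_quat"
      using frame by (auto simp: quat_frame_def)
    \<comment> \<open>Conjugation is multiplicative, so the product of the rotated frame is the
      conjugate of \<open>v\<^sub>1 * v\<^sub>2 * v\<^sub>3 = - 1\<close>.\<close>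
    have "?c v\<^sub>1 * ?c v\<^sub>2 = w * v\<^sub>1 * (inverse w * w) * v\<^sub>2 * inverse w" by (simp only: mult.assoc)
    also have "\<dots> = w * v\<^sub>3 * inverse w" using frame w by (simp add: quat_frame_def mult.assoc)
    finally have "?c v\<^sub>1 * ?c v\<^sub>2 * ?c v\<^sub>3 = w * v\<^sub>3 * (inverse w * w) * v\<^sub>3 * inverse w" by (simp only: mult.assoc)
    also have "\<dots> = w * (v\<^sub>3 * v\<^sub>3) * inverse w" using w by (simp add: mult.assoc)
    also have "\<dots> = - 1" using frame w by (simp add: quat_frame_def)
    finally have "?c v\<^sub>1 * ?c v\<^sub>2 * ?c v\<^sub>3 = - 1" .
    then have "jacobian (net_map P) s\<^sub>0 t\<^sub>0 u\<^sub>0 = (?n * f) * (?n * g) * (?n * h)"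
      unfolding jacobian_def d det_im_coords [OF im im im, OF im_frame]
      by (simp del: quat_mult_simps)
    then show ?thesis using w nz' by simp
  qed
  moreover have "net_map P s\<^sub>0 t\<^sub>0 u\<^sub>0 \<noteq> None" using pt by (simp add: net_map_eq_None_iff)
  moreover have "\<exists>U W. trilinear_poly U \<and> trilinear_poly W \<and>
        (\<forall>s\<in>{0..1}. \<forall>t\<in>{0..1}. \<forall>u\<in>{0..1}. net_map P s t u = qfrac (U s t u) (W s t u))"
    using tri by (intro exI [of _ "\<lambda>s t u. fst (P s t u)"] exI [of _ "\<lambda>s t u. snd (P s t u)"]) (auto simp: net_map_def)
  ultimately show ?thesis
    using iso pt(1-3) unfolding DC_cube_def isotropic_iff_net_map by blast
qed

section \<open>The Miquel point\<close>

text \<open>With the centre \<open>c\<close> measured from \<open>p\<close>, equidistance of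
  \<open>p\<close> and \<open>p + y\<close> means
  \<open>2 * (c \<bullet> y) = y \<bullet> y\<close>. The left side is linear in \<open>y\<close>,
  so the two given points of the circle determine it on the span of \<open>e\<close> and
  \<open>f\<close>.\<close>

lemma circle_through_inner:
  fixes p e f x :: quat
  assumes "x \<in> circle_through p (p + \<alpha> *\<^sub>R e) (p + \<beta> *\<^sub>R f)" "\<alpha> \<noteq> 0" "\<beta> \<noteq> 0"
    and x: "x - p = \<xi> *\<^sub>R e + \<eta> *\<^sub>R f"
  shows "(x - p) \<bullet> (x - p) = \<xi> * \<alpha> * (e \<bullet> e) + \<eta> * \<beta> * (f \<bullet> f)"
proof -
  from assms(1) obtain m where m: "dist m (p + \<alpha> *\<^sub>R e) = dist m p" "dist m (p + \<beta> *\<^sub>R f) = dist m p"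
      "dist m x = dist m p"
    unfolding circle_through_def by blast
  define c where "c = m - p"
  have eq: "2 * (c \<bullet> y) = y \<bullet> y" if "dist m (p + y) = dist m p" for y
  proof -
    have "norm (c - y) = norm c" using that by (simp add: dist_norm c_def algebra_simps)
    then have "(c - y) \<bullet> (c - y) = c \<bullet> c" by (simp flip: power2_norm_eq_inner)
    then show ?thesis by (simp add: inner_diff_left inner_diff_right inner_commute)
  qed
  from eq [OF m(1)] eq [OF m(2)] assms(2,3)
  have ce: "2 * (c \<bullet> e) = \<alpha> * (e \<bullet> e)" and cf: "2 * (c \<bullet> f) = \<beta> * (f \<bullet> f)" by simp_all
  have "(x - p) \<bullet> (x - p) = 2 * (c \<bullet> (x - p))"
    using eq [of "x - p"] m(3) by simp
  also have "\<dots> = \<xi> * (2 * (c \<bullet> e)) + \<eta> * (2 * (c \<bullet> f))"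
    unfolding x by (simp add: inner_add_right)
  finally show ?thesis unfolding ce cf by simp
qed

lemma circle_through_plane:
  fixes p e f x :: quat
  assumes "x \<in> circle_through p (p + \<alpha> *\<^sub>R e) (p + \<beta> *\<^sub>R f)"
  obtains \<xi> \<eta> where "x - p = \<xi> *\<^sub>R e + \<eta> *\<^sub>R f"
proof -
  from assms obtain a b c where "x = a *\<^sub>R p + b *\<^sub>R (p + \<alpha> *\<^sub>R e) + c *\<^sub>R (p + \<beta> *\<^sub>R f)" "a + b + c = 1"
    unfolding circle_through_def affine_hull_3 by blast
  moreover have "a *\<^sub>R p + b *\<^sub>R (p + \<alpha> *\<^sub>R e) + c *\<^sub>R (p + \<beta> *\<^sub>R f) = (a + b + c) *\<^sub>R p + (b * \<alpha>) *\<^sub>R e + (c * \<beta>) *\<^sub>R f"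
    by (simp add: algebra_simps)
  ultimately have "x - p = (b * \<alpha>) *\<^sub>R e + (c * \<beta>) *\<^sub>R f" by simp
  then show thesis by (rule that)
qed

lemma affine_hull_2_param:
  fixes x a b :: "'a::real_vector"
  assumes "x \<in> affine hull {a, b}"
  obtains r where "x = a + r *\<^sub>R (b - a)"
proof -
  from assms obtain u v where "x = u *\<^sub>R a + v *\<^sub>R b" "u + v = 1"
    unfolding affine_hull_2 by blast
  then have "x = a + v *\<^sub>R (b - a)" by (simp add: algebra_simps flip: scaleR_add_left)
  then show thesis by (rule that)
qed

text \<open>Subtracting the equations of two of the three circles leaves a linear equation in the
  coordinates \<open>\<xi>\<close>, \<open>\<eta>\<close> of the Miquel point.\<close>

lemma miquel_linear:
  fixes p\<^sub>1 p\<^sub>2 p\<^sub>4 x d e :: quat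
  assumes M: "Miquel_point p\<^sub>1 p\<^sub>2 (p\<^sub>2 + (1 - \<alpha>) *\<^sub>R e) p\<^sub>4 (p\<^sub>1 + \<beta> *\<^sub>R d) (p\<^sub>2 + \<gamma> *\<^sub>R (d + e)) x"
    and d: "d = p\<^sub>4 - p\<^sub>1" and e: "e = p\<^sub>1 - p\<^sub>2"
    and nz: "\<alpha> \<noteq> 0" "\<beta> \<noteq> 0" "\<gamma> \<noteq> 0" "\<alpha> \<noteq> 1" "\<beta> \<noteq> 1" "\<gamma> \<noteq> 1"
  defines "A \<equiv> d \<bullet> d" and "B \<equiv> e \<bullet> e" and "C \<equiv> d \<bullet> e"
  defines "\<kappa> \<equiv> \<beta> * A + (1 - \<alpha>) * B - \<gamma> * (A + B + 2 * C)"
  obtains \<xi> \<eta> where "x - p\<^sub>1 = \<xi> *\<^sub>R d + \<eta> *\<^sub>R e"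
    "- 2 * \<xi> * C - \<kappa> * \<xi> - \<eta> * B = \<alpha> * B" "\<xi> * A - \<kappa> * \<eta> = \<beta> * A"
proof -
  \<comment> \<open>Each circle passes through one vertex of the triangle; its points on the two
    adjacent sides are rewritten relative to that vertex.\<close>
  have p3: "p\<^sub>2 + (1 - \<alpha>) *\<^sub>R e = p\<^sub>1 + (- \<alpha>) *\<^sub>R e" by (simp add: e algebra_simps)
  have p5: "p\<^sub>1 + \<beta> *\<^sub>R d = p\<^sub>4 + (\<beta> - 1) *\<^sub>R d" by (simp add: d algebra_simps)
  have p6: "p\<^sub>2 + \<gamma> *\<^sub>R (d + e) = p\<^sub>4 + (\<gamma> - 1) *\<^sub>R (d + e)" by (simp add: d e algebra_simps)
  have c1: "x \<in> circle_through p\<^sub>1 (p\<^sub>1 + (- \<alpha>) *\<^sub>R e) (p\<^sub>1 + \<beta> *\<^sub>R d)"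
    and c2: "x \<in> circle_through p\<^sub>2 (p\<^sub>2 + (1 - \<alpha>) *\<^sub>R e) (p\<^sub>2 + \<gamma> *\<^sub>R (d + e))"
    and c4: "x \<in> circle_through p\<^sub>4 (p\<^sub>4 + (\<beta> - 1) *\<^sub>R d) (p\<^sub>4 + (\<gamma> - 1) *\<^sub>R (d + e))"
    using M unfolding Miquel_point_def p3 p5 [symmetric] p6 [symmetric] by blast+
  from circle_through_plane [OF c1] obtain \<xi> \<eta> where y: "x - p\<^sub>1 = \<eta> *\<^sub>R e + \<xi> *\<^sub>R d" by metis
  have y2: "x - p\<^sub>2 = (\<eta> + 1 - \<xi>) *\<^sub>R e + \<xi> *\<^sub>R (d + e)" and y4: "x - p\<^sub>4 = (\<xi> - 1 - \<eta>) *\<^sub>R d + \<eta> *\<^sub>R (d + e)"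
    using y by (simp_all add: d e algebra_simps)
  have sq: "(a *\<^sub>R e + b *\<^sub>R d) \<bullet> (a *\<^sub>R e + b *\<^sub>R d) = a\<^sup>2 * B + 2 * a * b * C + b\<^sup>2 * A" for a b
    by (simp add: A_def B_def C_def inner_add_left inner_add_right inner_commute power2_eq_square algebra_simps)
  \<comment> \<open>The left sides of the circle equations are expanded in the common basis
    \<open>e\<close>, \<open>d\<close>, while the right sides keep the side coordinates at each
    vertex. This makes the quadratic parts equal.\<close>
  have y2': "x - p\<^sub>2 = (\<eta> + 1) *\<^sub>R e + \<xi> *\<^sub>R d" and y4': "x - p\<^sub>4 = \<eta> *\<^sub>R e + (\<xi> - 1) *\<^sub>R d"
    by (simp_all add: y2 y4 algebra_simps)
  have de: "(d + e) \<bullet> (d + e) = A + B + 2 * C"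
    by (simp add: A_def B_def C_def inner_add_left inner_add_right inner_commute)
  have E1: "\<eta>\<^sup>2 * B + 2 * \<eta> * \<xi> * C + \<xi>\<^sup>2 * A = \<eta> * (- \<alpha>) * B + \<xi> * \<beta> * A"
    using circle_through_inner [OF c1 _ _ y] nz unfolding y sq by (simp add: A_def B_def)
  have E2: "(\<eta> + 1)\<^sup>2 * B + 2 * (\<eta> + 1) * \<xi> * C + \<xi>\<^sup>2 * A =
      (\<eta> + 1 - \<xi>) * (1 - \<alpha>) * B + \<xi> * \<gamma> * (A + B + 2 * C)"
    using circle_through_inner [OF c2 _ _ y2] nz unfolding y2' sq de by (simp add: B_def)
  have E4: "\<eta>\<^sup>2 * B + 2 * \<eta> * (\<xi> - 1) * C + (\<xi> - 1)\<^sup>2 * A =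
      (\<xi> - 1 - \<eta>) * (\<beta> - 1) * A + \<eta> * (\<gamma> - 1) * (A + B + 2 * C)"
    using circle_through_inner [OF c4 _ _ y4] nz unfolding y4' sq de by (simp add: A_def)
  show thesis
  proof (rule that)
    show "x - p\<^sub>1 = \<xi> *\<^sub>R d + \<eta> *\<^sub>R e" using y by simp
    show "- 2 * \<xi> * C - \<kappa> * \<xi> - \<eta> * B = \<alpha> * B"
      using E1 E2 unfolding \<kappa>_def by algebra
    show "\<xi> * A - \<kappa> * \<eta> = \<beta> * A"
      using E1 E4 unfolding \<kappa>_def by algebra
  qed
qed

lemma Im_triple_products:
  assumes "d \<in> Im_quat" "e \<in> Im_quat"
  shows "d * e * d = (d \<bullet> d) *\<^sub>R e - (2 * (d \<bullet> e)) *\<^sub>R d" "d * d = - of_real (d \<bullet> d)"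
  using assms by (simp_all add: Im_quat_def quat_eq_iff inner_quat_def of_real_def algebra_simps)

text \<open>The weight \<open>w\<^sub>7\<close> in polynomial form, with \<open>d = p\<^sub>4 - p\<^sub>1\<close>, \<open>e = p\<^sub>1 - p\<^sub>2\<close> and hence
  \<open>p\<^sub>2 - p\<^sub>4 = - (d + e)\<close>.\<close>

definition miquel_weight :: "real \<Rightarrow> real \<Rightarrow> real \<Rightarrow> quat \<Rightarrow> quat \<Rightarrow> quat" where
  "miquel_weight \<alpha> \<beta> \<gamma> d e = e * d -
     of_real (\<beta> * (d \<bullet> d) + (1 - \<alpha>) * (e \<bullet> e) - \<gamma> * (d \<bullet> d + e \<bullet> e + 2 * (d \<bullet> e)))"

text \<open>The first identity prepares comparison with the linear equations for the Miquel point.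
  As \<open>p\<^sub>7 - p\<^sub>2 = (p\<^sub>7 - p\<^sub>1) + e\<close> and
  \<open>p\<^sub>7 - p\<^sub>4 = (p\<^sub>7 - p\<^sub>1) - d\<close>, the other two carry the first
  weight formula to the second and third.\<close>

lemma miquel_weight_1:
  assumes "d \<in> Im_quat" "e \<in> Im_quat"
  shows "d * (- \<alpha> *\<^sub>R e - \<beta> *\<^sub>R d) * e = (\<alpha> * (e \<bullet> e)) *\<^sub>R d + (\<beta> * (d \<bullet> d)) *\<^sub>R e"
    "d * (- \<alpha> *\<^sub>R e - \<beta> *\<^sub>R d) * e + e * miquel_weight \<alpha> \<beta> \<gamma> d e =
       e * (\<gamma> *\<^sub>R (d + e) - (1 - \<alpha>) *\<^sub>R e) * (- (d + e))"
    "d * (- \<alpha> *\<^sub>R e - \<beta> *\<^sub>R d) * e - d * miquel_weight \<alpha> \<beta> \<gamma> d e =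
       (- (d + e)) * ((\<beta> - 1) *\<^sub>R d - (\<gamma> - 1) *\<^sub>R (d + e)) * d"
  using assms
  by (simp_all add: miquel_weight_def Im_quat_def quat_eq_iff inner_quat_def of_real_def algebra_simps)

section \<open>Edge forms in an orthonormal frame\<close>

text \<open>For a quaternion frame this is the algebra automorphism sending the standard units to
  it. It reduces identities in an arbitrary frame to coordinate computations.\<close>

definition frame_map :: "quat \<Rightarrow> quat \<Rightarrow> quat \<Rightarrow> quat \<Rightarrow> quat" where
  "frame_map v\<^sub>1 v\<^sub>2 v\<^sub>3 q = of_real (q_re q) + q_i q *\<^sub>R v\<^sub>1 + q_j q *\<^sub>R v\<^sub>2 + q_k q *\<^sub>R v\<^sub>3"

context
  fixes v\<^sub>1 v\<^sub>2 v\<^sub>3 :: quat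
  assumes frame: "quat_frame v\<^sub>1 v\<^sub>2 v\<^sub>3"
begin

lemma frame_map_add: "frame_map v\<^sub>1 v\<^sub>2 v\<^sub>3 (x + y) = frame_map v\<^sub>1 v\<^sub>2 v\<^sub>3 x + frame_map v\<^sub>1 v\<^sub>2 v\<^sub>3 y"
  and frame_map_diff: "frame_map v\<^sub>1 v\<^sub>2 v\<^sub>3 (x - y) = frame_map v\<^sub>1 v\<^sub>2 v\<^sub>3 x - frame_map v\<^sub>1 v\<^sub>2 v\<^sub>3 y"
  and frame_map_minus: "frame_map v\<^sub>1 v\<^sub>2 v\<^sub>3 (- x) = - frame_map v\<^sub>1 v\<^sub>2 v\<^sub>3 x"
  and frame_map_scaleR: "frame_map v\<^sub>1 v\<^sub>2 v\<^sub>3 (r *\<^sub>R x) = r *\<^sub>R frame_map v\<^sub>1 v\<^sub>2 v\<^sub>3 x"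
  by (simp_all add: frame_map_def of_real_def algebra_simps)

lemma frame_map_of_real: "frame_map v\<^sub>1 v\<^sub>2 v\<^sub>3 (of_real r) = of_real r"
  and frame_map_0: "frame_map v\<^sub>1 v\<^sub>2 v\<^sub>3 0 = 0"
  and frame_map_1: "frame_map v\<^sub>1 v\<^sub>2 v\<^sub>3 1 = 1"
  and frame_map_units: "frame_map v\<^sub>1 v\<^sub>2 v\<^sub>3 (Quat 0 1 0 0) = v\<^sub>1"
    "frame_map v\<^sub>1 v\<^sub>2 v\<^sub>3 (Quat 0 0 1 0) = v\<^sub>2" "frame_map v\<^sub>1 v\<^sub>2 v\<^sub>3 (Quat 0 0 0 1) = v\<^sub>3"
  by (simp_all add: frame_map_def of_real_def)

lemma frame_map_numeral: "frame_map v\<^sub>1 v\<^sub>2 v\<^sub>3 (numeral n) = numeral n"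
  using frame_map_of_real [of "numeral n"] by simp

lemma frame_map_mult: "frame_map v\<^sub>1 v\<^sub>2 v\<^sub>3 (x * y) = frame_map v\<^sub>1 v\<^sub>2 v\<^sub>3 x * frame_map v\<^sub>1 v\<^sub>2 v\<^sub>3 y"
  using frame by (simp add: frame_map_def quat_frame_def of_real_def algebra_simps)

lemma frame_map_qcnj: "frame_map v\<^sub>1 v\<^sub>2 v\<^sub>3 (qcnj x) = qcnj (frame_map v\<^sub>1 v\<^sub>2 v\<^sub>3 x)"
  using frame by (simp add: frame_map_def quat_frame_def qcnj_Im of_real_def)

lemma frame_map_inner: "frame_map v\<^sub>1 v\<^sub>2 v\<^sub>3 x \<bullet> frame_map v\<^sub>1 v\<^sub>2 v\<^sub>3 y = x \<bullet> y"
proof -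
  have inner_re: "x \<bullet> y = q_re (qcnj x * y)" for x y
    by (simp add: inner_quat_def)
  have re: "q_re (frame_map v\<^sub>1 v\<^sub>2 v\<^sub>3 z) = q_re z" for z
    using frame by (simp add: frame_map_def quat_frame_def Im_quat_def of_real_def)
  show ?thesis
    unfolding inner_re frame_map_qcnj [symmetric] frame_map_mult [symmetric] re ..
qed

lemma frame_map_surj:
  assumes "x \<in> Im_quat"
  obtains y where "x = frame_map v\<^sub>1 v\<^sub>2 v\<^sub>3 y" "y \<in> Im_quat"
proof -
  define y where "y = Quat 0 (v\<^sub>1 \<bullet> x) (v\<^sub>2 \<bullet> x) (v\<^sub>3 \<bullet> x)"
  note o1 = quat_frame_orth [OF frame]
  note o2 = quat_frame_orth [OF quat_frame_rot [OF frame]]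
  note o3 = quat_frame_orth [OF quat_frame_rot [OF quat_frame_rot [OF frame]]]
  have "x - frame_map v\<^sub>1 v\<^sub>2 v\<^sub>3 y = 0"
    by (rule quat_frame_eq_0 [OF frame])
      (use assms o1 o2 o3 in \<open>simp_all add: frame_map_def y_def inner_diff_right inner_add_right
        inner_commute [of v\<^sub>1 v\<^sub>3] inner_commute [of v\<^sub>2 v\<^sub>1] inner_commute [of v\<^sub>3 v\<^sub>2], simp add: inner_one_quat Im_quat_def\<close>)
  then show thesis
    by (intro that [of y]) (simp_all add: y_def Im_quat_def)
qed

lemma frame_map_pol:
  "pol (frame_map v\<^sub>1 v\<^sub>2 v\<^sub>3 a, frame_map v\<^sub>1 v\<^sub>2 v\<^sub>3 b) (frame_map v\<^sub>1 v\<^sub>2 v\<^sub>3 c, frame_map v\<^sub>1 v\<^sub>2 v\<^sub>3 d) =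
   frame_map v\<^sub>1 v\<^sub>2 v\<^sub>3 (pol (a, b) (c, d))"
  by (simp add: pol_def frame_map_add frame_map_mult frame_map_qcnj)

lemma frame_map_along:
  "q_re x = 0 \<and> q_j x = 0 \<and> q_k x = 0 \<Longrightarrow> \<exists>f. frame_map v\<^sub>1 v\<^sub>2 v\<^sub>3 x = f *\<^sub>R v\<^sub>1"
  by (auto simp: frame_map_def)

end

text \<open>The nine Bernstein coefficients of the biquadratic \<open>edge P t u\<close>: four at
  corners, four on sides of the parameter square, one central.\<close>

definition edge_coeffs :: "(real \<Rightarrow> real \<Rightarrow> real \<Rightarrow> quat \<times> quat) \<Rightarrow> quat set" where
  "edge_coeffs P = {pol (P 0 0 0) (P 1 0 0), pol (P 0 1 0) (P 1 1 0), pol (P 0 0 1) (P 1 0 1),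
     pol (P 0 1 1) (P 1 1 1),
     pol (P 0 0 0) (P 1 1 0) + pol (P 0 1 0) (P 1 0 0),
     pol (P 0 0 1) (P 1 1 1) + pol (P 0 1 1) (P 1 0 1),
     pol (P 0 0 0) (P 1 0 1) + pol (P 0 0 1) (P 1 0 0),
     pol (P 0 1 0) (P 1 1 1) + pol (P 0 1 1) (P 1 1 0), edge_centre P}"

lemma edges_along_coeffs:
  assumes "multiaffine P" and c: "\<And>x. x \<in> edge_coeffs P \<Longrightarrow> \<exists>f. x = f *\<^sub>R v"
  shows "edges_along P v"
proof -
  have quad: "\<exists>f. quad r a b c = f *\<^sub>R v" if "\<exists>f. a = f *\<^sub>R v" "\<exists>f. b = f *\<^sub>R v" "\<exists>f. c = f *\<^sub>R v" for r a b c
  proof -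
    from that obtain f g h where "a = f *\<^sub>R v" "b = g *\<^sub>R v" "c = h *\<^sub>R v" by blast
    then have "quad r a b c = quad r f g h *\<^sub>R v" by (simp add: quad_def algebra_simps)
    then show ?thesis by blast
  qed
  have "\<exists>f. edge P t u = f *\<^sub>R v" if tu: "t \<in> {0..1}" "u \<in> {0..1}" for t u
    unfolding edge_quad_1 [OF assms(1) tu] edge_middle_quad [OF assms(1) tu(2)]
      edge_quad_2 [OF assms(1) _ tu(2), of 0, simplified] edge_quad_2 [OF assms(1) _ tu(2), of 1, simplified]
    by (intro quad c) (simp_all add: edge_coeffs_def edge_def)
  then show ?thesis by (simp add: edges_along_def)
qed

text \<open>The control net of the Bezier formula after translating \<open>p\<^sub>1\<close> to the
  origin, with the last weight in polynomial form. It is read only at arguments 0 and 1.\<close>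

definition model_net ::
    "real \<Rightarrow> real \<Rightarrow> real \<Rightarrow> quat \<Rightarrow> quat \<Rightarrow> quat \<Rightarrow> quat \<Rightarrow> quat \<Rightarrow> real \<Rightarrow> real \<Rightarrow> real \<Rightarrow> quat \<times> quat" where
  "model_net \<alpha> \<beta> \<gamma> v\<^sub>1 v\<^sub>2 v\<^sub>3 d e i j k = (if i = 0 then
      (if j = 0 then (if k = 0 then (1, 0) else (- d * v\<^sub>3, - v\<^sub>3))
       else (if k = 0 then (e * v\<^sub>2, - v\<^sub>2)
         else ((\<gamma> *\<^sub>R (d + e) - e) * (- (d + e)) * v\<^sub>1, - (d + e) * v\<^sub>1)))
    else
      (if j = 0 then (if k = 0 then (0, - v\<^sub>1) else (\<beta> *\<^sub>R d * d * v\<^sub>2, d * v\<^sub>2))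
       else (if k = 0 then (- (\<alpha> *\<^sub>R e) * e * v\<^sub>3, e * v\<^sub>3)
         else (d * (- \<alpha> *\<^sub>R e - \<beta> *\<^sub>R d) * e, miquel_weight \<alpha> \<beta> \<gamma> d e))))"

text \<open>The Miquel condition is already built into the polynomial weight, so the unwanted
  components cancel identically in the coordinates of \<open>d\<close>, \<open>e\<close> and the
  three ratios.\<close>

lemma model_net_standard:
  fixes d e :: quat
  assumes "d \<in> Im_quat" "e \<in> Im_quat"
    and "x \<in> edge_coeffs (model_net \<alpha> \<beta> \<gamma> (Quat 0 1 0 0) (Quat 0 0 1 0) (Quat 0 0 0 1) d e)"
  shows "q_re x = 0 \<and> q_j x = 0 \<and> q_k x = 0"
proof -
  from assms(3) [unfolded edge_coeffs_def edge_centre_def insert_iff empty_iff]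
  show ?thesis
    by (elim disjE FalseE; hypsubst; insert assms(1,2); simp add: model_net_def pol_def
      miquel_weight_def Im_quat_def inner_quat_def of_real_def algebra_simps)
qed

lemma model_net_along:
  assumes frame: "quat_frame v\<^sub>1 v\<^sub>2 v\<^sub>3" and "d \<in> Im_quat" "e \<in> Im_quat"
    and x: "x \<in> edge_coeffs (model_net \<alpha> \<beta> \<gamma> v\<^sub>1 v\<^sub>2 v\<^sub>3 d e)"
  shows "\<exists>f. x = f *\<^sub>R v\<^sub>1"
proof -
  let ?m = "frame_map v\<^sub>1 v\<^sub>2 v\<^sub>3"
  obtain d' e' where de: "d = ?m d'" "d' \<in> Im_quat" "e = ?m e'" "e' \<in> Im_quat"
    using frame_map_surj [OF frame] assms(2,3) by metis
  define N where "N = model_net \<alpha> \<beta> \<gamma> (Quat 0 1 0 0) (Quat 0 0 1 0) (Quat 0 0 0 1) d' e'"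
  note hom = frame_map_add [OF frame] frame_map_diff [OF frame] frame_map_minus [OF frame]
    frame_map_scaleR [OF frame] frame_map_mult [OF frame] frame_map_of_real [OF frame]
    frame_map_numeral [OF frame]
    frame_map_0 [OF frame] frame_map_1 [OF frame] frame_map_units [OF frame]
  \<comment> \<open>The automorphism respects products, conjugation and inner products, so net and
    polar forms are images of those for the standard frame.\<close>
  have N: "model_net \<alpha> \<beta> \<gamma> v\<^sub>1 v\<^sub>2 v\<^sub>3 d e i j k = (?m (fst (N i j k)), ?m (snd (N i j k)))" for i j k
    by (simp add: N_def model_net_def miquel_weight_def de hom frame_map_inner [OF frame])
  have P: "pol (model_net \<alpha> \<beta> \<gamma> v\<^sub>1 v\<^sub>2 v\<^sub>3 d e i j k) (model_net \<alpha> \<beta> \<gamma> v\<^sub>1 v\<^sub>2 v\<^sub>3 d e i' j' k') =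
      ?m (pol (N i j k) (N i' j' k'))" for i j k i' j' k'
    unfolding N frame_map_pol [OF frame] by simp
  have "edge_coeffs (model_net \<alpha> \<beta> \<gamma> v\<^sub>1 v\<^sub>2 v\<^sub>3 d e) = ?m ` edge_coeffs N"
    unfolding edge_coeffs_def edge_centre_def image_insert image_empty P hom ..
  with x obtain y where "x = ?m y" "y \<in> edge_coeffs N" by blast
  then show ?thesis
    using model_net_standard [OF de(2,4)] frame_map_along [OF frame] unfolding N_def by metis
qed

section \<open>Dupin nets\<close>

text \<open>The three weight formulas appear cleared of inverses, hence as polynomial relations that
  the cyclic shift merely permutes.\<close>

definition miquel_config ::
    "quat \<Rightarrow> quat \<Rightarrow> quat \<Rightarrow> quat \<Rightarrow> quat \<Rightarrow> quat \<Rightarrow> quat \<Rightarrow> quat \<Rightarrow> bool" where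
  "miquel_config p\<^sub>1 p\<^sub>2 p\<^sub>3 p\<^sub>4 p\<^sub>5 p\<^sub>6 p\<^sub>7 w \<longleftrightarrow>
     p\<^sub>1 \<in> Im_quat \<and> p\<^sub>2 \<in> Im_quat \<and> p\<^sub>4 \<in> Im_quat \<and> p\<^sub>7 \<in> Im_quat \<and>
     p\<^sub>3 \<in> affine hull {p\<^sub>1, p\<^sub>2} \<and> p\<^sub>5 \<in> affine hull {p\<^sub>1, p\<^sub>4} \<and> p\<^sub>6 \<in> affine hull {p\<^sub>2, p\<^sub>4} \<and>
     p\<^sub>1 \<noteq> p\<^sub>2 \<and> p\<^sub>2 \<noteq> p\<^sub>4 \<and> p\<^sub>4 \<noteq> p\<^sub>1 \<and> p\<^sub>3 \<noteq> p\<^sub>1 \<and> p\<^sub>5 \<noteq> p\<^sub>1 \<and> w \<noteq> 0 \<and>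
     (p\<^sub>7 - p\<^sub>1) * w = (p\<^sub>4 - p\<^sub>1) * (p\<^sub>3 - p\<^sub>5) * (p\<^sub>1 - p\<^sub>2) \<and>
     (p\<^sub>7 - p\<^sub>2) * w = (p\<^sub>1 - p\<^sub>2) * (p\<^sub>6 - p\<^sub>3) * (p\<^sub>2 - p\<^sub>4) \<and>
     (p\<^sub>7 - p\<^sub>4) * w = (p\<^sub>2 - p\<^sub>4) * (p\<^sub>5 - p\<^sub>6) * (p\<^sub>4 - p\<^sub>1)"

lemma Im_quat_closed: "x \<in> Im_quat \<Longrightarrow> y \<in> Im_quat \<Longrightarrow> x + y \<in> Im_quat"
  "x \<in> Im_quat \<Longrightarrow> y \<in> Im_quat \<Longrightarrow> x - y \<in> Im_quat" "x \<in> Im_quat \<Longrightarrow> r *\<^sub>R x \<in> Im_quat"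
  by (simp_all add: Im_quat_def)

text \<open>Non-collinear triples have distinct members. If two vertices coincided, the line through
  them would shrink to a point and force a point on it to equal a vertex.\<close>

lemma Miquel_point_distinct:
  assumes "Miquel_point p\<^sub>1 p\<^sub>2 p\<^sub>3 p\<^sub>4 p\<^sub>5 p\<^sub>6 p\<^sub>7"
    and "p\<^sub>3 \<in> affine hull {p\<^sub>1, p\<^sub>2}" "p\<^sub>5 \<in> affine hull {p\<^sub>1, p\<^sub>4}" "p\<^sub>6 \<in> affine hull {p\<^sub>2, p\<^sub>4}"
  shows "p\<^sub>3 \<noteq> p\<^sub>1" "p\<^sub>5 \<noteq> p\<^sub>1" "p\<^sub>3 \<noteq> p\<^sub>5" "p\<^sub>3 \<noteq> p\<^sub>2" "p\<^sub>6 \<noteq> p\<^sub>2" "p\<^sub>6 \<noteq> p\<^sub>3" "p\<^sub>5 \<noteq> p\<^sub>4" "p\<^sub>6 \<noteq> p\<^sub>4" "p\<^sub>5 \<noteq> p\<^sub>6"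
    "p\<^sub>1 \<noteq> p\<^sub>2" "p\<^sub>2 \<noteq> p\<^sub>4" "p\<^sub>4 \<noteq> p\<^sub>1"
proof -
  have nc: "a \<noteq> b \<and> a \<noteq> c \<and> b \<noteq> c" if "\<not> collinear {a, b, c}" for a b c :: quat
    using that by (metis collinear_2 insert_absorb2 insert_commute)
  show *: "p\<^sub>3 \<noteq> p\<^sub>1" "p\<^sub>5 \<noteq> p\<^sub>1" "p\<^sub>3 \<noteq> p\<^sub>5" "p\<^sub>3 \<noteq> p\<^sub>2" "p\<^sub>6 \<noteq> p\<^sub>2" "p\<^sub>6 \<noteq> p\<^sub>3" "p\<^sub>5 \<noteq> p\<^sub>4" "p\<^sub>6 \<noteq> p\<^sub>4" "p\<^sub>5 \<noteq> p\<^sub>6"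
    using assms(1) nc unfolding Miquel_point_def by blast+
  have sing: "affine hull {a} = {a}" for a :: quat
    by (rule hull_same) simp
  show "p\<^sub>1 \<noteq> p\<^sub>2" "p\<^sub>2 \<noteq> p\<^sub>4" "p\<^sub>4 \<noteq> p\<^sub>1"
    using assms(2-4) * by (auto simp: sing)
qed

lemma miquel_config_exists:
  assumes im: "p\<^sub>1 \<in> Im_quat" "p\<^sub>2 \<in> Im_quat" "p\<^sub>4 \<in> Im_quat"
    and hull: "p\<^sub>3 \<in> affine hull {p\<^sub>1, p\<^sub>2}" "p\<^sub>5 \<in> affine hull {p\<^sub>1, p\<^sub>4}" "p\<^sub>6 \<in> affine hull {p\<^sub>2, p\<^sub>4}"
    and M: "Miquel_point p\<^sub>1 p\<^sub>2 p\<^sub>3 p\<^sub>4 p\<^sub>5 p\<^sub>6 p\<^sub>7"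
  obtains w where "miquel_config p\<^sub>1 p\<^sub>2 p\<^sub>3 p\<^sub>4 p\<^sub>5 p\<^sub>6 p\<^sub>7 w"
proof -
  note ne = Miquel_point_distinct [OF M hull]
  define d e where "d = p\<^sub>4 - p\<^sub>1" and "e = p\<^sub>1 - p\<^sub>2"
  have de: "d \<in> Im_quat" "e \<in> Im_quat" using im by (simp_all add: d_def e_def Im_quat_closed)
  from affine_hull_2_param [OF hull(1)] obtain \<alpha> where \<alpha>: "p\<^sub>3 = p\<^sub>1 + \<alpha> *\<^sub>R (p\<^sub>2 - p\<^sub>1)" .
  from affine_hull_2_param [OF hull(2)] obtain \<beta> where \<beta>: "p\<^sub>5 = p\<^sub>1 + \<beta> *\<^sub>R (p\<^sub>4 - p\<^sub>1)" .
  from affine_hull_2_param [OF hull(3)] obtain \<gamma> where \<gamma>: "p\<^sub>6 = p\<^sub>2 + \<gamma> *\<^sub>R (p\<^sub>4 - p\<^sub>2)" .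
  have p3: "p\<^sub>3 = p\<^sub>2 + (1 - \<alpha>) *\<^sub>R e" and p5: "p\<^sub>5 = p\<^sub>1 + \<beta> *\<^sub>R d" and p6: "p\<^sub>6 = p\<^sub>2 + \<gamma> *\<^sub>R (d + e)"
    by (simp_all add: \<alpha> \<beta> \<gamma> d_def e_def algebra_simps)
  have nz: "\<alpha> \<noteq> 0" "\<beta> \<noteq> 0" "\<gamma> \<noteq> 0" "\<alpha> \<noteq> 1" "\<beta> \<noteq> 1" "\<gamma> \<noteq> 1"
    using ne \<alpha> \<beta> \<gamma> by auto
  define w where "w = miquel_weight \<alpha> \<beta> \<gamma> d e"
  define \<kappa> where "\<kappa> = \<beta> * (d \<bullet> d) + (1 - \<alpha>) * (e \<bullet> e) - \<gamma> * (d \<bullet> d + e \<bullet> e + 2 * (d \<bullet> e))"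
  from miquel_linear [OF M [unfolded p3 p5 p6] d_def e_def nz] obtain \<xi> \<eta> where
    y: "p\<^sub>7 - p\<^sub>1 = \<xi> *\<^sub>R d + \<eta> *\<^sub>R e" and L: "- 2 * \<xi> * (d \<bullet> e) - \<kappa> * \<xi> - \<eta> * (e \<bullet> e) = \<alpha> * (e \<bullet> e)"
      "\<xi> * (d \<bullet> d) - \<kappa> * \<eta> = \<beta> * (d \<bullet> d)"
    unfolding \<kappa>_def by metis
  \<comment> \<open>The coefficients along \<open>d\<close> and \<open>e\<close> turn out to be the
    left sides of the two linear equations in \<open>L\<close>.\<close>
  have "(p\<^sub>7 - p\<^sub>1) * w = \<xi> *\<^sub>R (d * e * d) + \<eta> *\<^sub>R (e * e * d) - \<kappa> *\<^sub>R (\<xi> *\<^sub>R d + \<eta> *\<^sub>R e)"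
    unfolding y w_def miquel_weight_def \<kappa>_def [symmetric] by (simp add: of_real_def algebra_simps)
  also have "\<dots> = (- 2 * \<xi> * (d \<bullet> e) - \<kappa> * \<xi> - \<eta> * (e \<bullet> e)) *\<^sub>R d + (\<xi> * (d \<bullet> d) - \<kappa> * \<eta>) *\<^sub>R e"
    unfolding Im_triple_products(1) [OF de] Im_triple_products(2) [OF de(2,2)]
    by (simp add: of_real_def algebra_simps)
  also have "\<dots> = d * (- \<alpha> *\<^sub>R e - \<beta> *\<^sub>R d) * e"
    unfolding L miquel_weight_1(1) [OF de] ..
  finally have 1: "(p\<^sub>7 - p\<^sub>1) * w = d * (- \<alpha> *\<^sub>R e - \<beta> *\<^sub>R d) * e" .
  have d35: "- \<alpha> *\<^sub>R e - \<beta> *\<^sub>R d = p\<^sub>3 - p\<^sub>5" and d63: "\<gamma> *\<^sub>R (d + e) - (1 - \<alpha>) *\<^sub>R e = p\<^sub>6 - p\<^sub>3"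
    and d56: "(\<beta> - 1) *\<^sub>R d - (\<gamma> - 1) *\<^sub>R (d + e) = p\<^sub>5 - p\<^sub>6" and d24: "- (d + e) = p\<^sub>2 - p\<^sub>4"
    unfolding \<alpha> \<beta> \<gamma> d_def e_def by (simp_all add: algebra_simps)
  have "(p\<^sub>7 - p\<^sub>2) * w = (p\<^sub>7 - p\<^sub>1) * w + e * w" by (simp add: e_def algebra_simps)
  then have 2: "(p\<^sub>7 - p\<^sub>2) * w = e * (p\<^sub>6 - p\<^sub>3) * (p\<^sub>2 - p\<^sub>4)"
    unfolding 1 unfolding w_def miquel_weight_1(2) [OF de] d63 d24 .
  have "(p\<^sub>7 - p\<^sub>4) * w = (p\<^sub>7 - p\<^sub>1) * w - d * w" by (simp add: d_def algebra_simps)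
  then have 4: "(p\<^sub>7 - p\<^sub>4) * w = (p\<^sub>2 - p\<^sub>4) * (p\<^sub>5 - p\<^sub>6) * d"
    unfolding 1 unfolding w_def miquel_weight_1(3) [OF de] d56 d24 .
  have "w \<noteq> 0"
  proof
    assume "w = 0"
    then have "d * (p\<^sub>3 - p\<^sub>5) * e = 0" using 1 unfolding d35 by simp
    then show False using ne by (simp add: d_def e_def)
  qed
  moreover have "p\<^sub>7 \<in> Im_quat"
    using y de im by (metis Im_quat_closed(1,3) diff_add_cancel)
  ultimately show thesis
    using 1 [unfolded d35] 2 4 im hull ne
    by (intro that [of w]) (simp add: miquel_config_def flip: d_def e_def)
qed

lemma miquel_config_rot:
  assumes "miquel_config p\<^sub>1 p\<^sub>2 p\<^sub>3 p\<^sub>4 p\<^sub>5 p\<^sub>6 p\<^sub>7 w" "p\<^sub>6 \<noteq> p\<^sub>2" "p\<^sub>3 \<noteq> p\<^sub>2"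
  shows "miquel_config p\<^sub>2 p\<^sub>4 p\<^sub>6 p\<^sub>1 p\<^sub>3 p\<^sub>5 p\<^sub>7 w"
  using assms unfolding miquel_config_def by (simp add: insert_commute)

definition dupin_net ::
    "(real \<Rightarrow> real \<Rightarrow> real \<Rightarrow> quat \<times> quat) \<Rightarrow> quat \<Rightarrow> quat \<Rightarrow> quat \<Rightarrow> quat \<Rightarrow> quat \<Rightarrow> quat \<Rightarrow> quat \<Rightarrow>
     quat \<Rightarrow> quat \<Rightarrow> quat \<Rightarrow> quat \<Rightarrow> bool" where
  "dupin_net P p\<^sub>1 p\<^sub>2 p\<^sub>3 p\<^sub>4 p\<^sub>5 p\<^sub>6 p\<^sub>7 v\<^sub>1 v\<^sub>2 v\<^sub>3 w \<longleftrightarrow>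
     multiaffine P \<and> quat_frame v\<^sub>1 v\<^sub>2 v\<^sub>3 \<and> miquel_config p\<^sub>1 p\<^sub>2 p\<^sub>3 p\<^sub>4 p\<^sub>5 p\<^sub>6 p\<^sub>7 w \<and>
     P 0 0 0 = (1, 0) \<and> P 1 0 0 = (- p\<^sub>1 * v\<^sub>1, - v\<^sub>1) \<and> P 0 1 0 = (- p\<^sub>2 * v\<^sub>2, - v\<^sub>2) \<and>
     P 1 1 0 = (p\<^sub>3 * (p\<^sub>1 - p\<^sub>2) * v\<^sub>3, (p\<^sub>1 - p\<^sub>2) * v\<^sub>3) \<and> P 0 0 1 = (- p\<^sub>4 * v\<^sub>3, - v\<^sub>3) \<and>
     P 1 0 1 = (p\<^sub>5 * (p\<^sub>4 - p\<^sub>1) * v\<^sub>2, (p\<^sub>4 - p\<^sub>1) * v\<^sub>2) \<and>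
     P 0 1 1 = (p\<^sub>6 * (p\<^sub>2 - p\<^sub>4) * v\<^sub>1, (p\<^sub>2 - p\<^sub>4) * v\<^sub>1) \<and> P 1 1 1 = (p\<^sub>7 * w, w)"

text \<open>The shift permutes \<open>p\<^sub>1, p\<^sub>2, p\<^sub>4\<close> and the frame
  cyclically, and the control points follow the same pattern. The two inequalities give
  nondegeneracy at the new first vertex \<open>p\<^sub>2\<close>.\<close>

lemma dupin_net_rot:
  assumes "dupin_net P p\<^sub>1 p\<^sub>2 p\<^sub>3 p\<^sub>4 p\<^sub>5 p\<^sub>6 p\<^sub>7 v\<^sub>1 v\<^sub>2 v\<^sub>3 w" "p\<^sub>6 \<noteq> p\<^sub>2" "p\<^sub>3 \<noteq> p\<^sub>2"
  shows "dupin_net (rot P) p\<^sub>2 p\<^sub>4 p\<^sub>6 p\<^sub>1 p\<^sub>3 p\<^sub>5 p\<^sub>7 v\<^sub>2 v\<^sub>3 v\<^sub>1 w"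
  using assms multiaffine_rot [of P] unfolding dupin_net_def
  by (auto simp: rot_def intro: quat_frame_rot miquel_config_rot)

lemma dupin_net_edges_along:
  assumes "dupin_net P p\<^sub>1 p\<^sub>2 p\<^sub>3 p\<^sub>4 p\<^sub>5 p\<^sub>6 p\<^sub>7 v\<^sub>1 v\<^sub>2 v\<^sub>3 w"
  shows "edges_along P v\<^sub>1"
proof -
  from assms have P: "multiaffine P" and frame: "quat_frame v\<^sub>1 v\<^sub>2 v\<^sub>3"
    and config: "miquel_config p\<^sub>1 p\<^sub>2 p\<^sub>3 p\<^sub>4 p\<^sub>5 p\<^sub>6 p\<^sub>7 w"
    and c: "P 0 0 0 = (1, 0)" "P 1 0 0 = (- p\<^sub>1 * v\<^sub>1, - v\<^sub>1)" "P 0 1 0 = (- p\<^sub>2 * v\<^sub>2, - v\<^sub>2)"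
     "P 1 1 0 = (p\<^sub>3 * (p\<^sub>1 - p\<^sub>2) * v\<^sub>3, (p\<^sub>1 - p\<^sub>2) * v\<^sub>3)" "P 0 0 1 = (- p\<^sub>4 * v\<^sub>3, - v\<^sub>3)"
     "P 1 0 1 = (p\<^sub>5 * (p\<^sub>4 - p\<^sub>1) * v\<^sub>2, (p\<^sub>4 - p\<^sub>1) * v\<^sub>2)"
     "P 0 1 1 = (p\<^sub>6 * (p\<^sub>2 - p\<^sub>4) * v\<^sub>1, (p\<^sub>2 - p\<^sub>4) * v\<^sub>1)" "P 1 1 1 = (p\<^sub>7 * w, w)"
    by (auto simp: dupin_net_def)
  define d e where "d = p\<^sub>4 - p\<^sub>1" and "e = p\<^sub>1 - p\<^sub>2"
  from config have im: "p\<^sub>1 \<in> Im_quat" "p\<^sub>2 \<in> Im_quat" "p\<^sub>4 \<in> Im_quat"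
    and hull: "p\<^sub>3 \<in> affine hull {p\<^sub>1, p\<^sub>2}" "p\<^sub>5 \<in> affine hull {p\<^sub>1, p\<^sub>4}" "p\<^sub>6 \<in> affine hull {p\<^sub>2, p\<^sub>4}"
    and rel: "(p\<^sub>7 - p\<^sub>1) * w = (p\<^sub>4 - p\<^sub>1) * (p\<^sub>3 - p\<^sub>5) * (p\<^sub>1 - p\<^sub>2)"
     "(p\<^sub>7 - p\<^sub>2) * w = (p\<^sub>1 - p\<^sub>2) * (p\<^sub>6 - p\<^sub>3) * (p\<^sub>2 - p\<^sub>4)" and "e \<noteq> 0"
    by (auto simp: miquel_config_def e_def)
  have de: "d \<in> Im_quat" "e \<in> Im_quat" using im by (simp_all add: d_def e_def Im_quat_closed)
  from affine_hull_2_param [OF hull(1)] obtain \<alpha> where \<alpha>: "p\<^sub>3 = p\<^sub>1 + \<alpha> *\<^sub>R (p\<^sub>2 - p\<^sub>1)" .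
  from affine_hull_2_param [OF hull(2)] obtain \<beta> where \<beta>: "p\<^sub>5 = p\<^sub>1 + \<beta> *\<^sub>R (p\<^sub>4 - p\<^sub>1)" .
  from affine_hull_2_param [OF hull(3)] obtain \<gamma> where \<gamma>: "p\<^sub>6 = p\<^sub>2 + \<gamma> *\<^sub>R (p\<^sub>4 - p\<^sub>2)" .
  have d35: "p\<^sub>3 - p\<^sub>5 = - \<alpha> *\<^sub>R e - \<beta> *\<^sub>R d" and d63: "p\<^sub>6 - p\<^sub>3 = \<gamma> *\<^sub>R (d + e) - (1 - \<alpha>) *\<^sub>R e"
    and d24: "p\<^sub>2 - p\<^sub>4 = - (d + e)" and d31: "p\<^sub>3 - p\<^sub>1 = - (\<alpha> *\<^sub>R e)" and d51: "p\<^sub>5 - p\<^sub>1 = \<beta> *\<^sub>R d"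
    and d61: "p\<^sub>6 - p\<^sub>1 = \<gamma> *\<^sub>R (d + e) - e"
    unfolding \<alpha> \<beta> \<gamma> d_def e_def by (simp_all add: algebra_simps)
  \<comment> \<open>Subtracting two relations eliminates \<open>p\<^sub>7\<close>; cancelling
    \<open>e\<close> then identifies the weight with the polynomial one.\<close>
  have "e * w = (p\<^sub>7 - p\<^sub>2) * w - (p\<^sub>7 - p\<^sub>1) * w" by (simp add: e_def algebra_simps)
  also have "\<dots> = e * miquel_weight \<alpha> \<beta> \<gamma> d e"
    unfolding rel d35 d63 d24 d_def [symmetric] e_def [symmetric] miquel_weight_1(2) [OF de, of \<alpha> \<beta> \<gamma>, symmetric]
    by simp
  finally have w: "w = miquel_weight \<alpha> \<beta> \<gamma> d e" using \<open>e \<noteq> 0\<close> by simp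
  define N where "N = model_net \<alpha> \<beta> \<gamma> v\<^sub>1 v\<^sub>2 v\<^sub>3 d e"
  \<comment> \<open>Translation by \<open>- p\<^sub>1\<close> on homogeneous pairs; it preserves the
    polar form because \<open>p\<^sub>1\<close> is imaginary.\<close>
  define T where "T x = (fst x - p\<^sub>1 * snd x, snd x)" for x
  have polT: "pol (T x) (T y) = pol x y" for x y
    using qcnj_Im [OF im(1)] by (simp add: pol_def T_def algebra_simps)
  have T: "T (P 0 0 0) = N 0 0 0" "T (P 1 0 0) = N 1 0 0" "T (P 0 1 0) = N 0 1 0" "T (P 0 0 1) = N 0 0 1"
     "T (P 1 1 0) = N 1 1 0" "T (P 1 0 1) = N 1 0 1" "T (P 0 1 1) = N 0 1 1" "T (P 1 1 1) = N 1 1 1"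
  proof -
    have diff: "p * x - p\<^sub>1 * x = (p - p\<^sub>1) * x" "p * x * y - p\<^sub>1 * (x * y) = (p - p\<^sub>1) * x * y" for p x y
      by (simp_all add: algebra_simps)
    show "T (P 0 0 0) = N 0 0 0" "T (P 1 0 0) = N 1 0 0" "T (P 0 1 0) = N 0 1 0" "T (P 0 0 1) = N 0 0 1"
      by (simp_all add: T_def c N_def model_net_def d_def e_def algebra_simps)
    show "T (P 1 1 0) = N 1 1 0" "T (P 1 0 1) = N 1 0 1" "T (P 0 1 1) = N 0 1 1"
      unfolding T_def c fst_conv snd_conv diff d31 d51 d61 d24 e_def [symmetric] d_def [symmetric]
      by (simp_all add: N_def model_net_def)
    show "T (P 1 1 1) = N 1 1 1"
      unfolding T_def c fst_conv snd_conv diff rel d35 e_def [symmetric] d_def [symmetric]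
      by (simp add: N_def model_net_def w)
  qed
  have "edge_coeffs P = edge_coeffs N"
    unfolding edge_coeffs_def edge_centre_def T [symmetric] polT ..
  then show ?thesis
    using edges_along_coeffs [OF P] model_net_along [OF frame de] unfolding N_def by metis
qed

section \<open>Nets recovered from their corners\<close>

lemma isotropic_lin:
  assumes "pol a a = 0" "pol b b = 0" "1 \<bullet> pol a b = 0"
  shows "pol (lin x a b) (lin x a b) = 0"
proof -
  have "pol a b + pol b a = 0"
    using assms(3) unfolding qcnj_pol [of a b, symmetric] by (simp add: inner_one_quat quat_eq_iff)
  then show ?thesis using assms by (simp add: pol_lin quad_def)
qed

text \<open>Isotropy spreads from corners to edges, faces and the cube, one parameter at a time: a
  segment between isotropic pairs is isotropic once their polar form has no real part, and here it
  is a multiple of a frame vector.\<close>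

lemma isotropicI:
  assumes P: "multiaffine P" and along: "edges_along P v\<^sub>1" "edges_along (rot P) v\<^sub>2" "edges_along (rot (rot P)) v\<^sub>3"
    and v: "v\<^sub>1 \<in> Im_quat" "v\<^sub>2 \<in> Im_quat" "v\<^sub>3 \<in> Im_quat"
    and corner: "\<And>i j k. i \<in> {0, 1} \<Longrightarrow> j \<in> {0, 1} \<Longrightarrow> k \<in> {0, 1} \<Longrightarrow> pol (P i j k) (P i j k) = 0"
  shows "isotropic P"
proof -
  have v': "1 \<bullet> v\<^sub>1 = 0" "1 \<bullet> v\<^sub>2 = 0" "1 \<bullet> v\<^sub>3 = 0"
    using v by (simp_all add: inner_one_quat Im_quat_def)
  have 3: "pol (P i j u) (P i j u) = 0" if "i \<in> {0, 1}" "j \<in> {0, 1}" "u \<in> {0..1}" for i j u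
  proof -
    have "i \<in> {0..1}" "j \<in> {0..1}" using that by auto
    then show ?thesis
      using isotropic_lin [OF corner corner, of i j 0 i j 1 u] that edges_along_orth [OF along(3) v'(3), of i j]
        multiaffineD(3) [OF P, of i j u] by (simp add: edge_def rot_def)
  qed
  have 2: "pol (P i t u) (P i t u) = 0" if "i \<in> {0, 1}" "t \<in> {0..1}" "u \<in> {0..1}" for i t u
  proof -
    have "i \<in> {0..1}" using that by auto
    then show ?thesis
      using isotropic_lin [OF 3 3, of i 0 u i 1 u t] that edges_along_orth [OF along(2) v'(2), of u i]
        multiaffineD(2) [OF P, of i t u] by (simp add: edge_def rot_def)
  qed
  have "pol (P s t u) (P s t u) = 0" if "s \<in> {0..1}" "t \<in> {0..1}" "u \<in> {0..1}" for s t u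
    using isotropic_lin [OF 2 2, of 0 t u 1 t u s] that edges_along_orth [OF along(1) v'(1), of t u]
      multiaffineD(1) [OF P, of s t u] by (simp add: edge_def)
  then show ?thesis by (simp add: isotropic_def)
qed

lemma net_determined:
  assumes P: "multiaffine P" "isotropic P" "orth12 P" "orth12 (rot P)" "orth12 (rot (rot P))"
    and Q: "multiaffine Q" "isotropic Q" "edges_along Q v\<^sub>1" "edges_along (rot Q) v\<^sub>2" "edges_along (rot (rot Q)) v\<^sub>3"
    and frame: "quat_frame v\<^sub>1 v\<^sub>2 v\<^sub>3"
    and c: "P 0 0 0 = (1, 0)" "Q 0 0 0 = (1, 0)" "P 1 0 0 = Q 1 0 0" "P 0 1 0 = Q 0 1 0" "P 0 0 1 = Q 0 0 1"
    and same: "\<And>i j k. i \<in> {0, 1} \<Longrightarrow> j \<in> {0, 1} \<Longrightarrow> k \<in> {0, 1} \<Longrightarrow> net_map P i j k = net_map Q i j k"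
    and fin: "\<And>i j k. i \<in> {0, 1} \<Longrightarrow> j \<in> {0, 1} \<Longrightarrow> k \<in> {0, 1} \<Longrightarrow> (i, j, k) \<noteq> (0, 0, 0) \<Longrightarrow> net_map Q i j k \<noteq> None"
    and stu: "s \<in> {0..1}" "t \<in> {0..1}" "u \<in> {0..1}"
  shows "P s t u = Q s t u"
proof -
  have nz: "snd (Q 1 0 0) \<noteq> 0" "snd (Q 0 1 0) \<noteq> 0" "snd (Q 0 0 1) \<noteq> 0"
    using fin by (simp_all add: net_map_eq_None_iff)
  \<comment> \<open>Both numerators are the same finite point times the weight, so it suffices to
    match weights.\<close>
  have pt: "P i j k = Q i j k"
    if "i \<in> {0, 1}" "j \<in> {0, 1}" "k \<in> {0, 1}" "(i, j, k) \<noteq> (0, 0, 0)" "snd (P i j k) = snd (Q i j k)" for i j k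
  proof -
    have "snd (Q i j k) \<noteq> 0" using fin [OF that(1-4)] by (simp add: net_map_eq_None_iff)
    then have "fst (P i j k) * inverse (snd (Q i j k)) = fst (Q i j k) * inverse (snd (Q i j k))"
      using same [OF that(1-3)] that(5) by (simp add: net_map_def qfrac_def)
    with \<open>snd (Q i j k) \<noteq> 0\<close> that(5) show ?thesis by (simp add: prod_eq_iff)
  qed
  have along4: "edges_along (rot (rot (rot Q))) v\<^sub>1" using Q(3) by (simp add: rot3)
  note fr2 = quat_frame_rot [OF frame]
  note fr3 = quat_frame_rot [OF fr2]
  note P2 = multiaffine_rot [OF P(1)] isotropic_rot [OF P(2)]
  note P3 = multiaffine_rot [OF P2(1)] isotropic_rot [OF P2(2)]
  note Q2 = multiaffine_rot [OF Q(1)] isotropic_rot [OF Q(2)]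
  note Q3 = multiaffine_rot [OF Q2(1)] isotropic_rot [OF Q2(2)]
  have "snd (P 1 1 0) = snd (Q 1 1 0)"
    by (rule face_determined [OF P(1-3) Q(1-4) frame]) (use c nz in auto)
  then have 110: "P 1 1 0 = Q 1 1 0" by (intro pt) (simp_all add: rot_def)
  have "snd (rot P 1 1 0) = snd (rot Q 1 1 0)"
    by (rule face_determined [OF P2 P(4) Q2 Q(4,5) fr2]) (use c nz in \<open>auto simp: rot_def\<close>)
  then have 011: "P 0 1 1 = Q 0 1 1" by (intro pt) (simp_all add: rot_def)
  have "snd (rot (rot P) 1 1 0) = snd (rot (rot Q) 1 1 0)"
    by (rule face_determined [OF P3 P(5) Q3 Q(5) along4 fr3]) (use c nz in \<open>auto simp: rot_def\<close>)
  then have 101: "P 1 0 1 = Q 1 0 1" by (intro pt) (simp_all add: rot_def)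
  let ?\<delta> = "snd (P 1 1 1) - snd (Q 1 1 1)"
  \<comment> \<open>The net and its two shifts give the components along \<open>v\<^sub>2\<close>,
    \<open>v\<^sub>3\<close> and \<open>v\<^sub>1\<close>.\<close>
  have "1 \<bullet> ?\<delta> = 0" "v\<^sub>2 \<bullet> ?\<delta> = 0"
    by (rule centre_determined [OF P(1-3) Q(1-4) frame]; use c nz 110 011 101 in simp)+
  moreover have "v\<^sub>3 \<bullet> (snd (rot P 1 1 1) - snd (rot Q 1 1 1)) = 0"
    by (rule centre_determined [OF P2 P(4) Q2 Q(4,5) fr2]; use c nz 110 011 101 in \<open>simp add: rot_def\<close>)
  moreover have "v\<^sub>1 \<bullet> (snd (rot (rot P) 1 1 1) - snd (rot (rot Q) 1 1 1)) = 0"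
    by (rule centre_determined [OF P3 P(5) Q3 Q(5) along4 fr3]; use c nz 110 011 101 in \<open>simp add: rot_def\<close>)
  ultimately have "?\<delta> = 0"
    by (intro quat_frame_eq_0 [OF frame]) (simp_all add: rot_def)
  then have "P 1 1 1 = Q 1 1 1" by (intro pt) (simp_all add: rot_def)
  then show ?thesis
    using multiaffine_expand [OF P(1) stu] multiaffine_expand [OF Q(1) stu] c 110 011 101 by simp
qed

section \<open>Rescaling\<close>

lemma qfrac_eq_Some_iff: "qfrac U W = Some p \<longleftrightarrow> W \<noteq> 0 \<and> U = p * W"
  by (auto simp: qfrac_def mult.assoc)

lemma qfrac_mult_right: "q \<noteq> 0 \<Longrightarrow> qfrac (U * q) (W * q) = qfrac U W"
  by (auto simp: qfrac_def nonzero_inverse_mult_distrib mult.assoc simp flip: mult.assoc [of q])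

lemma qfrac_scaleR: "r \<noteq> 0 \<Longrightarrow> qfrac (r *\<^sub>R U) (r *\<^sub>R W) = qfrac U W"
  by (simp add: qfrac_def nonzero_inverse_scaleR_distrib)

lemma qcnj_inverse: "qcnj (inverse x) = inverse (qcnj x)"
  using inverse_qcnj [of "qcnj x"] inverse_qcnj [of x] by simp

text \<open>A common right factor leaves the fraction unchanged; removing it normalises the corner
  at infinity to \<open>(1, 0)\<close>.\<close>

definition net_divide :: "(real \<Rightarrow> real \<Rightarrow> real \<Rightarrow> quat \<times> quat) \<Rightarrow> quat \<Rightarrow> real \<Rightarrow> real \<Rightarrow> real \<Rightarrow> quat \<times> quat" where
  "net_divide P q s t u = (fst (P s t u) * inverse q, snd (P s t u) * inverse q)"

lemma rot_net_divide: "rot (net_divide P q) = net_divide (rot P) q"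
  by (simp add: rot_def net_divide_def fun_eq_iff)

lemma net_map_net_divide: "q \<noteq> 0 \<Longrightarrow> net_map (net_divide P q) s t u = net_map P s t u"
  by (simp add: net_map_def net_divide_def qfrac_mult_right)

lemma multiaffine_net_divide:
  assumes "multiaffine P"
  shows "multiaffine (net_divide P q)"
proof -
  define g where "g x = (fst x * inverse q, snd x * inverse q)" for x :: "quat \<times> quat"
  have g: "g (lin r x y) = lin r (g x) (g y)" for r x y
    by (simp add: g_def lin_def algebra_simps)
  have "net_divide P q s t u = g (P s t u)" for s t u
    by (simp add: net_divide_def g_def)
  then show ?thesis
    unfolding multiaffine_def using multiaffineD [OF assms] g by metis
qed

lemma orth12_net_divide:
  assumes "orth12 P" "q \<noteq> 0"
  shows "orth12 (net_divide P q)"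
proof -
  have "edge (net_divide P q) t u = inverse (qcnj q) * edge P t u * inverse q" for P t u
    by (simp add: edge_def net_divide_def pol_def qcnj_inverse algebra_simps)
  then show ?thesis
    using assms by (simp add: orth12_def rot_net_divide inner_conjugate) (simp add: net_divide_def)
qed

lemma interval_moebius_bounds:
  assumes "a > 0" "s \<in> {0..1}"
  shows "1 - s + a * s > 0" "interval_moebius a s \<in> {0..1}"
    "(1 - s + a * s) * interval_moebius a s = a * s"
    "(1 - s + a * s) * (1 - interval_moebius a s) = 1 - s"
proof -
  have n: "0 \<le> a * s" "0 \<le> 1 - s" using assms by auto
  moreover have "1 - s > 0 \<or> a * s > 0" using assms by (cases "s = 1") auto
  ultimately show p: "1 - s + a * s > 0" by linarith
  then show "interval_moebius a s \<in> {0..1}"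
    using n by (simp add: interval_moebius_def)
  show m: "(1 - s + a * s) * interval_moebius a s = a * s"
    using p by (simp add: interval_moebius_def)
  then show "(1 - s + a * s) * (1 - interval_moebius a s) = 1 - s"
    by (simp add: right_diff_distrib)
qed

lemma interval_moebius_0_1 [simp]: "interval_moebius a 0 = 0" "a > 0 \<Longrightarrow> interval_moebius a 1 = 1"
  by (simp_all add: interval_moebius_def)

text \<open>Homogeneous lift of a reparametrization: the denominators of the three interval maps are
  multiplied in, which restores degree one. A corner is thereby scaled by the factors of those
  parameters that equal 1.\<close>

definition rescale ::
    "real \<Rightarrow> real \<Rightarrow> real \<Rightarrow> (real \<Rightarrow> real \<Rightarrow> real \<Rightarrow> quat \<times> quat) \<Rightarrow> real \<Rightarrow> real \<Rightarrow> real \<Rightarrow> quat \<times> quat" where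
  "rescale a b c P s t u = ((1 - s + a * s) * (1 - t + b * t) * (1 - u + c * u)) *\<^sub>R
     P (interval_moebius a s) (interval_moebius b t) (interval_moebius c u)"

lemma rot_rescale: "rot (rescale a b c P) = rescale b c a (rot P)"
  by (simp add: rot_def rescale_def fun_eq_iff mult.commute mult.left_commute)

lemma net_map_rescale:
  assumes "a > 0" "b > 0" "c > 0" "s \<in> {0..1}" "t \<in> {0..1}" "u \<in> {0..1}"
  shows "net_map (rescale a b c P) s t u =
    net_map P (interval_moebius a s) (interval_moebius b t) (interval_moebius c u)"
  using interval_moebius_bounds(1) [OF assms(1,4)] interval_moebius_bounds(1) [OF assms(2,5)]
    interval_moebius_bounds(1) [OF assms(3,6)]
  by (simp add: net_map_def rescale_def qfrac_scaleR)

lemma multiaffine_rescale: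
  assumes P: "multiaffine P" and abc: "a > 0" "b > 0" "c > 0"
  shows "multiaffine (rescale a b c P)"
proof -
  \<comment> \<open>Clears the denominator of one interval map; \<open>x\<close> and
    \<open>y\<close> stand for the factors of the other two parameters.\<close>
  have lin: "(x * (1 - s + a * s) * y) *\<^sub>R lin (interval_moebius a s) p q =
      lin s ((x * y) *\<^sub>R p) ((x * a * y) *\<^sub>R q)" if "a > 0" "s \<in> {0..1}" for x y a s and p q :: "quat \<times> quat"
  proof -
    have "(x * (1 - s + a * s) * y) *\<^sub>R lin (interval_moebius a s) p q =
      (x * y * ((1 - s + a * s) * (1 - interval_moebius a s))) *\<^sub>R p +
      (x * y * ((1 - s + a * s) * interval_moebius a s)) *\<^sub>R q"
      by (simp add: lin_def scaleR_add_right ac_simps)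
    then show ?thesis
      unfolding interval_moebius_bounds(3,4) [OF that] by (simp add: lin_def ac_simps)
  qed
  show ?thesis
    unfolding multiaffine_def
  proof (intro ballI conjI)
    fix s t u :: real assume stu: "s \<in> {0..1}" "t \<in> {0..1}" "u \<in> {0..1}"
    note m = interval_moebius_bounds(2) [OF abc(1) stu(1)] interval_moebius_bounds(2) [OF abc(2) stu(2)]
      interval_moebius_bounds(2) [OF abc(3) stu(3)]
    show "rescale a b c P s t u = lin s (rescale a b c P 0 t u) (rescale a b c P 1 t u)"
      unfolding rescale_def multiaffineD(1) [OF P m]
      using lin [OF abc(1) stu(1), of 1] abc by (simp add: mult.assoc)
    show "rescale a b c P s t u = lin t (rescale a b c P s 0 u) (rescale a b c P s 1 u)"
      unfolding rescale_def multiaffineD(2) [OF P m] using lin [OF abc(2) stu(2)] abc by simp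
    show "rescale a b c P s t u = lin u (rescale a b c P s t 0) (rescale a b c P s t 1)"
      unfolding rescale_def multiaffineD(3) [OF P m] using lin [OF abc(3) stu(3), of _ 1] abc by simp
  qed
qed

lemma edges_along_rescale:
  assumes "edges_along P v" "a > 0" "b > 0" "c > 0"
  shows "edges_along (rescale a b c P) v"
  unfolding edges_along_def
proof (intro ballI)
  fix t u :: real assume tu: "t \<in> {0..1}" "u \<in> {0..1}"
  from assms(1) obtain f where "edge P (interval_moebius b t) (interval_moebius c u) = f *\<^sub>R v"
    unfolding edges_along_def
    using interval_moebius_bounds(2) [OF assms(3) tu(1)] interval_moebius_bounds(2) [OF assms(4) tu(2)] by blast
  then have "\<exists>r. edge (rescale a b c P) t u = r *\<^sub>R (f *\<^sub>R v)"
    using assms(2) by (simp add: edge_def rescale_def)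
  then show "\<exists>f. edge (rescale a b c P) t u = f *\<^sub>R v" by (metis scaleR_scaleR)
qed

lemma isotropic_rescale:
  assumes "isotropic P" "a > 0" "b > 0" "c > 0"
  shows "isotropic (rescale a b c P)"
  using assms(1) net_map_rescale [OF assms(2-4)] interval_moebius_bounds(2) assms(2-4)
  unfolding isotropic_iff_net_map by metis

section \<open>Bezier nets and half-lines from infinity\<close>

definition bezier_net :: "(quat \<times> quat) list \<Rightarrow> real \<Rightarrow> real \<Rightarrow> real \<Rightarrow> quat \<times> quat" where
  "bezier_net cs s t u =
     (trilinear_Bernstein_sum (map fst cs) s t u, trilinear_Bernstein_sum (map snd cs) s t u)"

lemma quat_Bezier_eq_net_map: "quat_Bezier cs = net_map (bezier_net cs)"
  by (simp add: fun_eq_iff quat_Bezier_def net_map_def bezier_net_def)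

lemma trilinear_Bernstein_sum_lin:
  "trilinear_Bernstein_sum c s t u =
    lin s (lin t (lin u (c ! 0) (c ! 4)) (lin u (c ! 2) (c ! 6))) (lin t (lin u (c ! 1) (c ! 5)) (lin u (c ! 3) (c ! 7)))"
  by (simp add: trilinear_Bernstein_sum_def Bernstein_def lin_def algebra_simps eval_nat_numeral)

lemma trilinear_poly_Bernstein_sum: "trilinear_poly (trilinear_Bernstein_sum c)"
proof -
  \<comment> \<open>Monomial coefficients are alternating sums of control values, by
    inclusion-exclusion over corners.\<close>
  define k where "k i j l = (if i = 0 then
      (if j = 0 then (if l = 0 then c ! 0 else c ! 4 - c ! 0)
       else (if l = 0 then c ! 2 - c ! 0 else c ! 6 - c ! 2 - c ! 4 + c ! 0))
    else
      (if j = 0 then (if l = 0 then c ! 1 - c ! 0 else c ! 5 - c ! 1 - c ! 4 + c ! 0)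
       else (if l = 0 then c ! 3 - c ! 1 - c ! 2 + c ! 0
         else c ! 7 - c ! 6 - c ! 5 - c ! 3 + c ! 1 + c ! 2 + c ! 4 - c ! 0)))" for i j l :: nat
  have "trilinear_Bernstein_sum c s t u = (\<Sum>i\<le>1. \<Sum>j\<le>1. \<Sum>l\<le>1. (s ^ i * t ^ j * u ^ l) *\<^sub>R k i j l)" for s t u
    unfolding trilinear_Bernstein_sum_lin lin_def by (simp add: k_def algebra_simps)
  then show ?thesis unfolding trilinear_poly_def by blast
qed

lemma half_line_image:
  assumes "v * v = - 1"
  shows "(\<lambda>s. qfrac (lin s 1 (- p * v)) (lin s 0 (- v))) ` {0..1} = half_line p v"
proof -
  have v: "v \<noteq> 0" using assms by auto
  have zero: "qfrac (lin 0 1 (- p * v)) (lin 0 0 (- v)) = None"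
    by (simp add: qfrac_def)
  \<comment> \<open>The denominator \<open>- s *\<^sub>R v\<close> has inverse \<open>v / s\<close>,
    because \<open>v\<close> squares to minus one. The ray parameter \<open>(1 - s) / s\<close>
    decreases from infinity to 0.\<close>
  have pos: "qfrac (lin s 1 (- p * v)) (lin s 0 (- v)) = Some (p + ((1 - s) / s) *\<^sub>R v)" if "s > 0" for s
  proof -
    have "(p + ((1 - s) / s) *\<^sub>R v) * (- s *\<^sub>R v) = - s *\<^sub>R (p * v) - (1 - s) *\<^sub>R (v * v)"
    proof -
      have "(p + r *\<^sub>R v) * (- s *\<^sub>R v) = - s *\<^sub>R (p * v) - (r * s) *\<^sub>R (v * v)" for r
        by (simp add: algebra_simps)
      from this [of "(1 - s) / s"] that show ?thesis by simp
    qed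
    then show ?thesis
      using that v unfolding qfrac_eq_Some_iff by (simp add: lin_def assms)
  qed
  show ?thesis
  proof (intro equalityI subsetI)
    fix x assume "x \<in> (\<lambda>s. qfrac (lin s 1 (- p * v)) (lin s 0 (- v))) ` {0..1}"
    then obtain s where s: "s \<in> {0..1}" "x = qfrac (lin s 1 (- p * v)) (lin s 0 (- v))" by blast
    show "x \<in> half_line p v"
    proof (cases "s = 0")
      case True
      then show ?thesis using s zero by (simp add: half_line_def)
    next
      case False
      then have "x = Some (p + ((1 - s) / s) *\<^sub>R v)" "(1 - s) / s \<ge> 0" using s pos by auto
      then show ?thesis unfolding half_line_def by blast
    qed
  next
    fix x assume "x \<in> half_line p v"
    then consider "x = None" | r where "r \<ge> 0" "x = Some (p + r *\<^sub>R v)"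
      unfolding half_line_def by blast
    then show "x \<in> (\<lambda>s. qfrac (lin s 1 (- p * v)) (lin s 0 (- v))) ` {0..1}"
    proof cases
      case 1
      then show ?thesis using zero by (intro image_eqI [of _ _ 0]) simp_all
    next
      case 2
      \<comment> \<open>The preimage \<open>1 / (1 + r)\<close> solves
        \<open>(1 - s) / s = r\<close>.\<close>
      have "(1 - 1 / (1 + r)) / (1 / (1 + r)) = r" using 2 by (simp add: field_simps)
      then show ?thesis
        using 2 pos [of "1 / (1 + r)"] by (intro image_eqI [of _ _ "1 / (1 + r)"]) simp_all
    qed
  qed
qed

text \<open>The midpoint of the edge is sent to \<open>p + inverse w\<close>, so lying on the ray
  fixes the direction of \<open>w\<close>; \<open>a\<close> is the reciprocal of the ray parameter
  there.\<close>

lemma half_line_weight: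
  assumes v: "v * v = - 1" and w: "w \<noteq> 0"
    and mem: "qfrac (lin (1/2) 1 (p * w)) (lin (1/2) 0 w) \<in> half_line p v"
  obtains a where "a > 0" "w = a *\<^sub>R (- v)"
proof -
  have "qfrac (lin (1/2) 1 (p * w)) (lin (1/2) 0 w) = Some (p + inverse w)"
    using w unfolding qfrac_eq_Some_iff by (simp add: lin_def algebra_simps)
  with mem obtain r where r: "inverse w = r *\<^sub>R v" "r \<ge> 0"
    unfolding half_line_def by auto
  with w have "r > 0" by (cases "r = 0") auto
  have "inverse v = - v" using v by (intro inverse_unique) simp
  then have "w = (1 / r) *\<^sub>R (- v)"
    using r by (metis inverse_eq_divide inverse_inverse_eq inverse_scaleR_distrib)
  with \<open>r > 0\<close> show thesis by (intro that [of "1 / r"]) simp_all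
qed

lemma half_line_not_singleton: "v \<noteq> 0 \<Longrightarrow> \<not> half_line p v \<subseteq> {None, Some p}"
proof
  assume "v \<noteq> 0" "half_line p v \<subseteq> {None, Some p}"
  moreover have "Some (p + 1 *\<^sub>R v) \<in> half_line p v"
    unfolding half_line_def by (intro insertI2 CollectI exI [of _ 1]) simp
  ultimately show False by auto
qed

section \<open>Existence and uniqueness\<close>

lemma pol_finite:
  assumes "p \<in> Im_quat" "fst x = p * snd x" "fst y = q * snd y"
  shows "pol x y = qcnj (snd x) * (q - p) * snd y"
  using qcnj_Im [OF assms(1)] by (simp add: pol_def assms(2,3) algebra_simps)

lemma affine_hull_Im:
  assumes "x \<in> affine hull {a, b}" "a \<in> Im_quat" "b \<in> Im_quat"
  shows "x \<in> Im_quat"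
  using affine_hull_2_param [OF assms(1)] assms(2,3) by (metis Im_quat_closed)

lemma dupin_net_DC_cube:
  assumes net: "dupin_net Q p\<^sub>1 p\<^sub>2 p\<^sub>3 p\<^sub>4 p\<^sub>5 p\<^sub>6 p\<^sub>7 v\<^sub>1 v\<^sub>2 v\<^sub>3 w"
    and ne: "p\<^sub>6 \<noteq> p\<^sub>2" "p\<^sub>3 \<noteq> p\<^sub>2" "p\<^sub>5 \<noteq> p\<^sub>4" "p\<^sub>6 \<noteq> p\<^sub>4"
    and tri: "trilinear_poly (\<lambda>s t u. fst (Q s t u))" "trilinear_poly (\<lambda>s t u. snd (Q s t u))"
  shows "edges_along Q v\<^sub>1" "edges_along (rot Q) v\<^sub>2" "edges_along (rot (rot Q)) v\<^sub>3"
    "isotropic Q" "DC_cube (net_map Q)"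
proof -
  note net2 = dupin_net_rot [OF net ne(1,2)]
  note net3 = dupin_net_rot [OF net2 ne(3,4)]
  show along: "edges_along Q v\<^sub>1" "edges_along (rot Q) v\<^sub>2" "edges_along (rot (rot Q)) v\<^sub>3"
    using dupin_net_edges_along net net2 net3 by blast+
  from net have Q: "multiaffine Q" and frame: "quat_frame v\<^sub>1 v\<^sub>2 v\<^sub>3"
    and config: "miquel_config p\<^sub>1 p\<^sub>2 p\<^sub>3 p\<^sub>4 p\<^sub>5 p\<^sub>6 p\<^sub>7 w"
    and c: "Q 0 0 0 = (1, 0)" "Q 1 0 0 = (- p\<^sub>1 * v\<^sub>1, - v\<^sub>1)" "Q 0 1 0 = (- p\<^sub>2 * v\<^sub>2, - v\<^sub>2)"
     "Q 1 1 0 = (p\<^sub>3 * (p\<^sub>1 - p\<^sub>2) * v\<^sub>3, (p\<^sub>1 - p\<^sub>2) * v\<^sub>3)" "Q 0 0 1 = (- p\<^sub>4 * v\<^sub>3, - v\<^sub>3)"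
     "Q 1 0 1 = (p\<^sub>5 * (p\<^sub>4 - p\<^sub>1) * v\<^sub>2, (p\<^sub>4 - p\<^sub>1) * v\<^sub>2)"
     "Q 0 1 1 = (p\<^sub>6 * (p\<^sub>2 - p\<^sub>4) * v\<^sub>1, (p\<^sub>2 - p\<^sub>4) * v\<^sub>1)" "Q 1 1 1 = (p\<^sub>7 * w, w)"
    unfolding dupin_net_def by blast+
  from frame have v: "v\<^sub>1 \<in> Im_quat" "v\<^sub>2 \<in> Im_quat" "v\<^sub>3 \<in> Im_quat" and v0: "v\<^sub>1 \<noteq> 0" "v\<^sub>2 \<noteq> 0" "v\<^sub>3 \<noteq> 0"
    by (auto simp: quat_frame_def)
  from config have im: "p\<^sub>1 \<in> Im_quat" "p\<^sub>2 \<in> Im_quat" "p\<^sub>4 \<in> Im_quat" "p\<^sub>7 \<in> Im_quat"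
    and hull: "p\<^sub>3 \<in> affine hull {p\<^sub>1, p\<^sub>2}" "p\<^sub>5 \<in> affine hull {p\<^sub>1, p\<^sub>4}" "p\<^sub>6 \<in> affine hull {p\<^sub>2, p\<^sub>4}"
    and dist: "p\<^sub>1 \<noteq> p\<^sub>2" "p\<^sub>4 \<noteq> p\<^sub>1" "p\<^sub>3 \<noteq> p\<^sub>1" "p\<^sub>5 \<noteq> p\<^sub>1"
    unfolding miquel_config_def by blast+
  have im': "p\<^sub>3 \<in> Im_quat" "p\<^sub>5 \<in> Im_quat" "p\<^sub>6 \<in> Im_quat"
    using affine_hull_Im hull im by blast+
  have self: "pol (p * x, x) (p * x, x) = 0" if "p \<in> Im_quat" for p x
    using pol_finite [OF that, of "(p * x, x)" "(p * x, x)" p] by simp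
  have corner: "pol (Q i j k) (Q i j k) = 0" if "i \<in> {0, 1}" "j \<in> {0, 1}" "k \<in> {0, 1}" for i j k
    using that self [OF im(1), of "- v\<^sub>1"] self [OF im(2), of "- v\<^sub>2"] self [OF im(3), of "- v\<^sub>3"]
      self [OF im(4)] self [OF im'(1), of "_ * _"] self [OF im'(2), of "_ * _"] self [OF im'(3), of "_ * _"]
    by (auto simp: c pol_infinity mult.assoc)
  show iso: "isotropic Q"
    by (rule isotropicI [OF Q along v corner])
  \<comment> \<open>The Jacobian is tested at the corner \<open>p\<^sub>1\<close>, where
    \<open>(s, t, u) = (1, 0, 0)\<close>; its edges lead to \<open>p\<^sub>0\<close>,
    \<open>p\<^sub>3\<close> and \<open>p\<^sub>5\<close>.\<close>
  have e: "edge Q 0 0 = - v\<^sub>1" "edge (rot Q) 0 1 = pol (Q 1 0 0) (Q 1 1 0)"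
     "edge (rot (rot Q)) 1 0 = pol (Q 1 0 0) (Q 1 0 1)"
    by (simp_all add: edge_def rot_def c pol_infinity)
  have "pol (Q 1 0 0) (Q 1 1 0) \<noteq> 0"
    using pol_finite [OF im(1), of "Q 1 0 0" "Q 1 1 0" p\<^sub>3] v0 dist by (simp add: c mult.assoc)
  moreover have "pol (Q 1 0 0) (Q 1 0 1) \<noteq> 0"
    using pol_finite [OF im(1), of "Q 1 0 0" "Q 1 0 1" p\<^sub>5] v0 dist by (simp add: c mult.assoc)
  ultimately show "DC_cube (net_map Q)"
    by (intro DC_cube_net_map [OF tri iso frame along, of 1 0 0]) (simp_all add: e v0 c)
qed

lemma dupin_net_corners:
  assumes "dupin_net Q p\<^sub>1 p\<^sub>2 p\<^sub>3 p\<^sub>4 p\<^sub>5 p\<^sub>6 p\<^sub>7 v\<^sub>1 v\<^sub>2 v\<^sub>3 w"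
  shows "has_corners (net_map Q)
    [None, Some p\<^sub>1, Some p\<^sub>2, Some p\<^sub>3, Some p\<^sub>4, Some p\<^sub>5, Some p\<^sub>6, Some p\<^sub>7]"
proof -
  from assms have v0: "v\<^sub>1 \<noteq> 0" "v\<^sub>2 \<noteq> 0" "v\<^sub>3 \<noteq> 0" "w \<noteq> 0" "p\<^sub>1 \<noteq> p\<^sub>2" "p\<^sub>4 \<noteq> p\<^sub>1" "p\<^sub>2 \<noteq> p\<^sub>4"
    and c: "Q 0 0 0 = (1, 0)" "Q 1 0 0 = (- p\<^sub>1 * v\<^sub>1, - v\<^sub>1)" "Q 0 1 0 = (- p\<^sub>2 * v\<^sub>2, - v\<^sub>2)"
     "Q 1 1 0 = (p\<^sub>3 * (p\<^sub>1 - p\<^sub>2) * v\<^sub>3, (p\<^sub>1 - p\<^sub>2) * v\<^sub>3)" "Q 0 0 1 = (- p\<^sub>4 * v\<^sub>3, - v\<^sub>3)"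
     "Q 1 0 1 = (p\<^sub>5 * (p\<^sub>4 - p\<^sub>1) * v\<^sub>2, (p\<^sub>4 - p\<^sub>1) * v\<^sub>2)"
     "Q 0 1 1 = (p\<^sub>6 * (p\<^sub>2 - p\<^sub>4) * v\<^sub>1, (p\<^sub>2 - p\<^sub>4) * v\<^sub>1)" "Q 1 1 1 = (p\<^sub>7 * w, w)"
    unfolding dupin_net_def quat_frame_def miquel_config_def by auto
  have "net_map Q 0 0 0 = None" "net_map Q 1 0 0 = Some p\<^sub>1" "net_map Q 0 1 0 = Some p\<^sub>2"
    "net_map Q 1 1 0 = Some p\<^sub>3" "net_map Q 0 0 1 = Some p\<^sub>4" "net_map Q 1 0 1 = Some p\<^sub>5"
    "net_map Q 0 1 1 = Some p\<^sub>6" "net_map Q 1 1 1 = Some p\<^sub>7"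
    using v0 by (simp_all add: net_map_eq_None_iff) (simp_all add: net_map_def c qfrac_eq_Some_iff mult.assoc)
  then show ?thesis
    unfolding has_corners_def by (auto simp: le_Suc_eq eval_nat_numeral)
qed

lemma dupin_net_frame:
  assumes "dupin_net Q p\<^sub>1 p\<^sub>2 p\<^sub>3 p\<^sub>4 p\<^sub>5 p\<^sub>6 p\<^sub>7 v\<^sub>1 v\<^sub>2 v\<^sub>3 w"
  shows "has_frame_at_infinity (net_map Q) p\<^sub>1 p\<^sub>2 p\<^sub>4 v\<^sub>1 v\<^sub>2 v\<^sub>3"
proof -
  from assms have Q: "multiaffine Q" and v: "v\<^sub>1 * v\<^sub>1 = - 1" "v\<^sub>2 * v\<^sub>2 = - 1" "v\<^sub>3 * v\<^sub>3 = - 1"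
    and c: "Q 0 0 0 = (1, 0)" "Q 1 0 0 = (- p\<^sub>1 * v\<^sub>1, - v\<^sub>1)" "Q 0 1 0 = (- p\<^sub>2 * v\<^sub>2, - v\<^sub>2)"
      "Q 0 0 1 = (- p\<^sub>4 * v\<^sub>3, - v\<^sub>3)"
    unfolding dupin_net_def quat_frame_def by blast+
  have "net_map Q x 0 0 = qfrac (lin x 1 (- p\<^sub>1 * v\<^sub>1)) (lin x 0 (- v\<^sub>1))"
    "net_map Q 0 x 0 = qfrac (lin x 1 (- p\<^sub>2 * v\<^sub>2)) (lin x 0 (- v\<^sub>2))"
    "net_map Q 0 0 x = qfrac (lin x 1 (- p\<^sub>4 * v\<^sub>3)) (lin x 0 (- v\<^sub>3))" if "x \<in> {0..1}" for x
    using multiaffineD(1) [OF Q that, of 0 0] multiaffineD(2) [OF Q _ that, of 0 0] multiaffineD(3) [OF Q _ _ that, of 0 0]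
    by (simp_all add: net_map_def c)
  then show ?thesis
    unfolding has_frame_at_infinity_def half_line_image [OF v(1), symmetric]
      half_line_image [OF v(2), symmetric] half_line_image [OF v(3), symmetric]
    by (intro conjI image_cong refl) auto
qed

lemma dupin_net_unique:
  assumes net: "dupin_net Q p\<^sub>1 p\<^sub>2 p\<^sub>3 p\<^sub>4 p\<^sub>5 p\<^sub>6 p\<^sub>7 v\<^sub>1 v\<^sub>2 v\<^sub>3 w"
    and Q: "isotropic Q" "edges_along Q v\<^sub>1" "edges_along (rot Q) v\<^sub>2" "edges_along (rot (rot Q)) v\<^sub>3"
    and G: "DC_cube G"
      "has_corners G [None, Some p\<^sub>1, Some p\<^sub>2, Some p\<^sub>3, Some p\<^sub>4, Some p\<^sub>5, Some p\<^sub>6, Some p\<^sub>7]"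
      "has_frame_at_infinity G p\<^sub>1 p\<^sub>2 p\<^sub>4 v\<^sub>1 v\<^sub>2 v\<^sub>3"
  shows "reparametrization (net_map Q) G"
proof -
  let ?ps = "[None, Some p\<^sub>1, Some p\<^sub>2, Some p\<^sub>3, Some p\<^sub>4, Some p\<^sub>5, Some p\<^sub>6, Some p\<^sub>7]"
  from net have Qm: "multiaffine Q" and frame: "quat_frame v\<^sub>1 v\<^sub>2 v\<^sub>3"
    and c: "Q 0 0 0 = (1, 0)" "Q 1 0 0 = (- p\<^sub>1 * v\<^sub>1, - v\<^sub>1)" "Q 0 1 0 = (- p\<^sub>2 * v\<^sub>2, - v\<^sub>2)"
      "Q 0 0 1 = (- p\<^sub>4 * v\<^sub>3, - v\<^sub>3)"
    unfolding dupin_net_def by blast+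
  from frame have v: "v\<^sub>1 * v\<^sub>1 = - 1" "v\<^sub>2 * v\<^sub>2 = - 1" "v\<^sub>3 * v\<^sub>3 = - 1"
    unfolding quat_frame_def by blast+
  obtain P\<^sub>0 where P0: "multiaffine P\<^sub>0" "isotropic P\<^sub>0" "orth12 P\<^sub>0" "orth12 (rot P\<^sub>0)" "orth12 (rot (rot P\<^sub>0))"
    and GP0: "\<And>s t u. s \<in> {0..1} \<Longrightarrow> t \<in> {0..1} \<Longrightarrow> u \<in> {0..1} \<Longrightarrow> G s t u = net_map P\<^sub>0 s t u"
    using DC_cube_net [OF G(1)] by metis
  have corner: "G (real i) (real j) (real k) = ?ps ! (i + 2 * j + 4 * k)" if "i \<le> 1" "j \<le> 1" "k \<le> 1" for i j k
    using G(2) that unfolding has_corners_def by blast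
  have Gc: "G 0 0 0 = None" "G 1 0 0 = Some p\<^sub>1" "G 0 1 0 = Some p\<^sub>2" "G 0 0 1 = Some p\<^sub>4"
    using corner [of 0 0 0] corner [of 1 0 0] corner [of 0 1 0] corner [of 0 0 1] by simp_all
  have w0: "snd (P\<^sub>0 0 0 0) = 0"
    using Gc(1) GP0 [of 0 0 0] by (simp add: net_map_eq_None_iff)
  define q where "q = fst (P\<^sub>0 0 0 0)"
  \<comment> \<open>Zero denominator alone allows numerator and denominator to vanish together. Then
    the first edge would take only the value \<open>p\<^sub>1\<close> away from
    \<open>s = 0\<close>, which is not a half-line.\<close>
  have q: "q \<noteq> 0"
  proof
    assume "q = 0"
    then have P00: "P\<^sub>0 0 0 0 = 0" using w0 by (simp add: q_def prod_eq_iff)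
    have "G s 0 0 \<in> {None, Some p\<^sub>1}" if "s \<in> {0..1}" for s
    proof (cases "s = 0")
      case False
      have "P\<^sub>0 s 0 0 = s *\<^sub>R P\<^sub>0 1 0 0"
        using multiaffineD(1) [OF P0(1) that, of 0 0] P00 by (simp add: lin_def)
      then have "G s 0 0 = G 1 0 0"
        using GP0 [OF that, of 0 0] GP0 [of 1 0 0] False by (simp add: net_map_def qfrac_scaleR)
      then show ?thesis using Gc by simp
    qed (use Gc in simp)
    then have "half_line p\<^sub>1 v\<^sub>1 \<subseteq> {None, Some p\<^sub>1}"
      using G(3) unfolding has_frame_at_infinity_def by (metis image_subsetI)
    moreover have "v\<^sub>1 \<noteq> 0" using v by auto
    ultimately show False using half_line_not_singleton by blast
  qed
  define P where "P = net_divide P\<^sub>0 q"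
  have GP: "G s t u = net_map P s t u" if "s \<in> {0..1}" "t \<in> {0..1}" "u \<in> {0..1}" for s t u
    using GP0 [OF that] q by (simp add: P_def net_map_net_divide)
  have P: "multiaffine P" "isotropic P" "orth12 P" "orth12 (rot P)" "orth12 (rot (rot P))"
    using P0 q by (simp_all add: P_def multiaffine_net_divide isotropic_iff_net_map net_map_net_divide
      orth12_net_divide rot_net_divide)
  have Pc: "P 0 0 0 = (1, 0)"
    using q w0 by (simp add: P_def net_divide_def q_def)
  have Pp: "\<exists>x. x \<noteq> 0 \<and> P i j k = (p * x, x)" if "G i j k = Some p" "i \<in> {0..1}" "j \<in> {0..1}" "k \<in> {0..1}" for i j k p
  proof -
    have "qfrac (fst (P i j k)) (snd (P i j k)) = Some p"
      using GP [OF that(2-4)] that(1) by (simp add: net_map_def)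
    then show ?thesis
      unfolding qfrac_eq_Some_iff by (intro exI [of _ "snd (P i j k)"]) (simp add: prod_eq_iff)
  qed
  have h: "1/2 \<in> {0..1::real}" by simp
  obtain x where x: "x \<noteq> 0" "P 1 0 0 = (p\<^sub>1 * x, x)" using Pp [OF Gc(2)] by auto
  obtain y where y: "y \<noteq> 0" "P 0 1 0 = (p\<^sub>2 * y, y)" using Pp [OF Gc(3)] by auto
  obtain z where z: "z \<noteq> 0" "P 0 0 1 = (p\<^sub>4 * z, z)" using Pp [OF Gc(4)] by auto
  \<comment> \<open>One interior point per edge is enough to read off the positive factor of its
    weight.\<close>
  have mem: "G (1/2) 0 0 \<in> half_line p\<^sub>1 v\<^sub>1" "G 0 (1/2) 0 \<in> half_line p\<^sub>2 v\<^sub>2" "G 0 0 (1/2) \<in> half_line p\<^sub>4 v\<^sub>3"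
    using G(3) h unfolding has_frame_at_infinity_def by blast+
  have "qfrac (lin (1/2) 1 (p\<^sub>1 * x)) (lin (1/2) 0 x) \<in> half_line p\<^sub>1 v\<^sub>1"
    using mem(1) GP [OF h, of 0 0] multiaffineD(1) [OF P(1) h, of 0 0] by (simp add: net_map_def Pc x)
  then obtain a where a: "a > 0" "x = a *\<^sub>R (- v\<^sub>1)" using half_line_weight [OF v(1) x(1)] by metis
  have "qfrac (lin (1/2) 1 (p\<^sub>2 * y)) (lin (1/2) 0 y) \<in> half_line p\<^sub>2 v\<^sub>2"
    using mem(2) GP [OF _ h, of 0 0] multiaffineD(2) [OF P(1) _ h, of 0 0] by (simp add: net_map_def Pc y)
  then obtain b where b: "b > 0" "y = b *\<^sub>R (- v\<^sub>2)" using half_line_weight [OF v(2) y(1)] by metis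
  have "qfrac (lin (1/2) 1 (p\<^sub>4 * z)) (lin (1/2) 0 z) \<in> half_line p\<^sub>4 v\<^sub>3"
    using mem(3) GP [OF _ _ h, of 0 0] multiaffineD(3) [OF P(1) _ _ h, of 0 0] by (simp add: net_map_def Pc z)
  then obtain d where d: "d > 0" "z = d *\<^sub>R (- v\<^sub>3)" using half_line_weight [OF v(3) z(1)] by metis
  \<comment> \<open>The three factors become the reparametrization: after this rescaling the weights
    at \<open>p\<^sub>1\<close>, \<open>p\<^sub>2\<close>, \<open>p\<^sub>4\<close> agree with those
    of \<open>P\<close>.\<close>
  define R where "R = rescale a b d Q"
  have R: "multiaffine R" "isotropic R" "edges_along R v\<^sub>1" "edges_along (rot R) v\<^sub>2" "edges_along (rot (rot R)) v\<^sub>3"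
    using Qm Q a(1) b(1) d(1)
    by (simp_all add: R_def rot_rescale multiaffine_rescale isotropic_rescale edges_along_rescale)
  have Rc: "R 0 0 0 = (1, 0)" "P 1 0 0 = R 1 0 0" "P 0 1 0 = R 0 1 0" "P 0 0 1 = R 0 0 1"
    using a b d by (simp_all add: R_def rescale_def c x y z)
  have Rmap: "net_map R i j k = net_map Q i j k \<and> net_map P i j k = net_map Q i j k \<and> ((i, j, k) \<noteq> (0, 0, 0) \<longrightarrow> net_map Q i j k \<noteq> None)"
    if ijk: "i \<in> {0, 1}" "j \<in> {0, 1}" "k \<in> {0, 1}" for i j k
  proof -
    from ijk have I: "i \<in> {0..1}" "j \<in> {0..1}" "k \<in> {0..1}" by auto
    from ijk obtain i' j' k' :: nat where n: "i = real i'" "j = real j'" "k = real k'" "i' \<le> 1" "j' \<le> 1" "k' \<le> 1"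
      by (metis insertE of_nat_0 of_nat_1 order_refl singletonD zero_le)
    have "net_map R i j k = net_map Q i j k"
      using net_map_rescale [OF a(1) b(1) d(1) I] ijk a b d by (auto simp: R_def)
    moreover have "net_map Q i j k = ?ps ! (i' + 2 * j' + 4 * k')" "net_map P i j k = ?ps ! (i' + 2 * j' + 4 * k')"
      using dupin_net_corners [OF net] corner n GP [OF I] unfolding has_corners_def by simp_all
    moreover have "?ps ! (i' + 2 * j' + 4 * k') \<noteq> None" if "(i, j, k) \<noteq> (0, 0, 0)"
      using that n by (auto simp: le_Suc_eq eval_nat_numeral)
    ultimately show ?thesis by metis
  qed
  have PR: "P s t u = R s t u" if "s \<in> {0..1}" "t \<in> {0..1}" "u \<in> {0..1}" for s t u
    by (rule net_determined [OF P R frame Pc Rc _ _ that]; use Rmap in metis)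
  have "G s t u = net_map Q (interval_moebius a s) (interval_moebius b t) (interval_moebius d u)"
    if stu: "s \<in> {0..1}" "t \<in> {0..1}" "u \<in> {0..1}" for s t u
    using GP [OF stu] PR [OF stu] net_map_rescale [OF a(1) b(1) d(1) stu, of Q]
    by (simp add: net_map_def R_def)
  then show ?thesis
    unfolding reparametrization_def using a(1) b(1) d(1) by blast
qed

theorem theorem4p1:
  fixes p\<^sub>1 p\<^sub>2 p\<^sub>3 p\<^sub>4 p\<^sub>5 p\<^sub>6 p\<^sub>7 v\<^sub>1 v\<^sub>2 v\<^sub>3 w\<^sub>7 :: quat
    and F :: "real \<Rightarrow> real \<Rightarrow> real \<Rightarrow> quat option"
  assumes "p\<^sub>1 \<in> Im_quat" and "p\<^sub>2 \<in> Im_quat" and "p\<^sub>4 \<in> Im_quat"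
    and "p\<^sub>3 \<in> affine hull {p\<^sub>1, p\<^sub>2}"
    and "p\<^sub>5 \<in> affine hull {p\<^sub>1, p\<^sub>4}"
    and "p\<^sub>6 \<in> affine hull {p\<^sub>2, p\<^sub>4}"
    and "Miquel_point p\<^sub>1 p\<^sub>2 p\<^sub>3 p\<^sub>4 p\<^sub>5 p\<^sub>6 p\<^sub>7"
    and "v\<^sub>1 \<in> Im_quat" and "v\<^sub>2 \<in> Im_quat"
    and "norm v\<^sub>1 = 1" and "norm v\<^sub>2 = 1" and "orthogonal v\<^sub>1 v\<^sub>2"
    and "v\<^sub>3 = v\<^sub>1 * v\<^sub>2"
    and "w\<^sub>7 = inverse (p\<^sub>7 - p\<^sub>1) * (p\<^sub>4 - p\<^sub>1) * (p\<^sub>3 - p\<^sub>5) * (p\<^sub>1 - p\<^sub>2)"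
    and "F = quat_Bezier
      [(1, 0),
       (- p\<^sub>1 * v\<^sub>1, - v\<^sub>1),
       (- p\<^sub>2 * v\<^sub>2, - v\<^sub>2),
       (p\<^sub>3 * (p\<^sub>1 - p\<^sub>2) * v\<^sub>3, (p\<^sub>1 - p\<^sub>2) * v\<^sub>3),
       (- p\<^sub>4 * v\<^sub>3, - v\<^sub>3),
       (p\<^sub>5 * (p\<^sub>4 - p\<^sub>1) * v\<^sub>2, (p\<^sub>4 - p\<^sub>1) * v\<^sub>2),
       (p\<^sub>6 * (p\<^sub>2 - p\<^sub>4) * v\<^sub>1, (p\<^sub>2 - p\<^sub>4) * v\<^sub>1),
       (p\<^sub>7 * w\<^sub>7, w\<^sub>7)]"
  shows "w\<^sub>7 = inverse (p\<^sub>7 - p\<^sub>2) * (p\<^sub>1 - p\<^sub>2) * (p\<^sub>6 - p\<^sub>3) * (p\<^sub>2 - p\<^sub>4) \<and>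
    w\<^sub>7 = inverse (p\<^sub>7 - p\<^sub>4) * (p\<^sub>2 - p\<^sub>4) * (p\<^sub>5 - p\<^sub>6) * (p\<^sub>4 - p\<^sub>1) \<and>
    (let corners = [None, Some p\<^sub>1, Some p\<^sub>2, Some p\<^sub>3, Some p\<^sub>4, Some p\<^sub>5, Some p\<^sub>6, Some p\<^sub>7] in
      DC_cube F \<and> has_corners F corners \<and> has_frame_at_infinity F p\<^sub>1 p\<^sub>2 p\<^sub>4 v\<^sub>1 v\<^sub>2 v\<^sub>3 \<and>
      (\<forall>G. DC_cube G \<and> has_corners G corners \<and> has_frame_at_infinity G p\<^sub>1 p\<^sub>2 p\<^sub>4 v\<^sub>1 v\<^sub>2 v\<^sub>3 \<longrightarrow>
        reparametrization F G))"
proof -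
  note im = assms(1-3) and hull = assms(4-6) and M = assms(7) and w7 = assms(14) and F = assms(15)
  have frame: "quat_frame v\<^sub>1 v\<^sub>2 v\<^sub>3"
    unfolding assms(13) using assms(8-12) by (intro quat_frameI)
  note ne = Miquel_point_distinct [OF M hull]
  obtain w where config: "miquel_config p\<^sub>1 p\<^sub>2 p\<^sub>3 p\<^sub>4 p\<^sub>5 p\<^sub>6 p\<^sub>7 w"
    using miquel_config_exists [OF im hull M] .
  then have rel: "(p\<^sub>7 - p\<^sub>1) * w = (p\<^sub>4 - p\<^sub>1) * (p\<^sub>3 - p\<^sub>5) * (p\<^sub>1 - p\<^sub>2)"
     "(p\<^sub>7 - p\<^sub>2) * w = (p\<^sub>1 - p\<^sub>2) * (p\<^sub>6 - p\<^sub>3) * (p\<^sub>2 - p\<^sub>4)"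
     "(p\<^sub>7 - p\<^sub>4) * w = (p\<^sub>2 - p\<^sub>4) * (p\<^sub>5 - p\<^sub>6) * (p\<^sub>4 - p\<^sub>1)"
    unfolding miquel_config_def by blast+
  \<comment> \<open>The right sides are products of nonzero differences, so \<open>p\<^sub>7\<close>
    differs from all three vertices and the inverses in the weight formulas are genuine.\<close>
  have "(p\<^sub>7 - p\<^sub>1) * w \<noteq> 0" "(p\<^sub>7 - p\<^sub>2) * w \<noteq> 0" "(p\<^sub>7 - p\<^sub>4) * w \<noteq> 0"
    unfolding rel using ne by simp_all
  then have cancel: "inverse (p\<^sub>7 - p\<^sub>1) * ((p\<^sub>7 - p\<^sub>1) * w) = w" "inverse (p\<^sub>7 - p\<^sub>2) * ((p\<^sub>7 - p\<^sub>2) * w) = w"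
    "inverse (p\<^sub>7 - p\<^sub>4) * ((p\<^sub>7 - p\<^sub>4) * w) = w"
    by (simp_all flip: mult.assoc)
  have "w\<^sub>7 = w" using w7 cancel(1) unfolding rel by (simp only: mult.assoc)
  with config have config: "miquel_config p\<^sub>1 p\<^sub>2 p\<^sub>3 p\<^sub>4 p\<^sub>5 p\<^sub>6 p\<^sub>7 w\<^sub>7" by simp
  have w2: "w\<^sub>7 = inverse (p\<^sub>7 - p\<^sub>2) * (p\<^sub>1 - p\<^sub>2) * (p\<^sub>6 - p\<^sub>3) * (p\<^sub>2 - p\<^sub>4)"
    and w4: "w\<^sub>7 = inverse (p\<^sub>7 - p\<^sub>4) * (p\<^sub>2 - p\<^sub>4) * (p\<^sub>5 - p\<^sub>6) * (p\<^sub>4 - p\<^sub>1)"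
    using cancel(2,3) unfolding rel \<open>w\<^sub>7 = w\<close> by (simp_all only: mult.assoc)
  define cs where "cs = [(1, 0), (- p\<^sub>1 * v\<^sub>1, - v\<^sub>1), (- p\<^sub>2 * v\<^sub>2, - v\<^sub>2),
       (p\<^sub>3 * (p\<^sub>1 - p\<^sub>2) * v\<^sub>3, (p\<^sub>1 - p\<^sub>2) * v\<^sub>3), (- p\<^sub>4 * v\<^sub>3, - v\<^sub>3),
       (p\<^sub>5 * (p\<^sub>4 - p\<^sub>1) * v\<^sub>2, (p\<^sub>4 - p\<^sub>1) * v\<^sub>2), (p\<^sub>6 * (p\<^sub>2 - p\<^sub>4) * v\<^sub>1, (p\<^sub>2 - p\<^sub>4) * v\<^sub>1),
       (p\<^sub>7 * w\<^sub>7, w\<^sub>7)]"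
  define Q where "Q = bezier_net cs"
  have FQ: "F = net_map Q"
    unfolding F Q_def cs_def quat_Bezier_eq_net_map ..
  have tri: "trilinear_poly (\<lambda>s t u. fst (Q s t u))" "trilinear_poly (\<lambda>s t u. snd (Q s t u))"
    using trilinear_poly_Bernstein_sum by (simp_all add: Q_def bezier_net_def)
  have "multiaffine Q"
    using multiaffine_Pair [OF tri [THEN trilinear_poly_multiaffine]] by simp
  with frame config have net: "dupin_net Q p\<^sub>1 p\<^sub>2 p\<^sub>3 p\<^sub>4 p\<^sub>5 p\<^sub>6 p\<^sub>7 v\<^sub>1 v\<^sub>2 v\<^sub>3 w\<^sub>7"
    unfolding dupin_net_def by (simp add: Q_def bezier_net_def trilinear_Bernstein_sum_lin cs_def)
  note props = dupin_net_DC_cube [OF net ne(5,4,7,8) tri]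
  show ?thesis
    unfolding Let_def FQ
    using w2 w4 props(5) dupin_net_corners [OF net] dupin_net_frame [OF net]
      dupin_net_unique [OF net props(4,1,2,3)] by blast
qed

end
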